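(* Let $m,s\in\mathbb{N}$ and let $\mathbb{K}=\prod_{i=1}^m\mathbb{F}_{q_i}$ and $\mathbb{F}=\prod_{i=1}^s\mathbb{F}_{p_i}$ be products of finite fields such that $|\mathbb{K}|$ and $|\mathbb{F}|$ are coprime. Then the function $\pi^{[1]}$ that sends an $(\mathbb{F},\mathbb{K})$-linearly closed clonoid $C$ to its unary part $C^{[1]}$, regarded as the tuple $(V_1,\dots,V_s)$ with $V_i=\{\pi_i\circ f\mid f\in C^{[1]}\}\subseteq\mathbb{F}_{p_i}^{\mathbb{K}}$, where $\pi_i\colon\mathbb{F}\to\mathbb{F}_{p_i}$ is the $i$-th projection, is an isomorphism between the lattice of all $(\mathbb{F},\mathbb{K})$-linearly closed clonoids and the direct product over $i\in\{1,\dots,s\}$ of the lattices of all $\mathbb{F}_{p_i}[\mathbb{K}^{\times}]$-submodules of $\mathbb{F}_{p_i}^{\mathbb{K}}$.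
   Context: $\mathbb{N}$ is the set of positive integers, and for a prime power $q$, $\mathbb{F}_q$ is the field with $q$ elements; here all $q_i$ and $p_i$ are prime powers (with repetitions allowed). For $k\in\mathbb{N}$, a $k$-ary function from $\mathbb{K}=\prod_{j=1}^m\mathbb{F}_{q_j}$ to $\mathbb{F}=\prod_{i=1}^s\mathbb{F}_{p_i}$ is a function $f\colon\prod_{j=1}^m\mathbb{F}_{q_j}^k\to\mathbb{F}$; unary means $k=1$. For a set $C$ of such functions of various arities, $C^{[k]}$ denotes the set of its $k$-ary members; $C^{[1]}$ is the unary part of $C$. An $(\mathbb{F},\mathbb{K})$-linearly closed clonoid is a non-empty set $C$ of finitary functions from $\mathbb{K}$ to $\mathbb{F}$ (of arities $k\in\mathbb{N}$) such that: (1) for all $n\in\mathbb{N}$, $\mathbf{a},\mathbf{b}\in\mathbb{F}$ and $f,g\in C^{[n]}$, we have $\mathbf{a}f+\mathbf{b}g\in C^{[n]}$, where $\mathbf{a}f$ denotes the component-wise product in $\prod_{i=1}^s\mathbb{F}_{p_i}$; (2) for all $l,n\in\mathbb{N}$, $f\in C^{[n]}$ and matrices $A_j\in\mathbb{F}_{q_j}^{n\times l}$ ($1\le j\le m$), the function $(\mathbf{x}_1,\dots,\mathbf{x}_m)\mapsto f(A_1\mathbf{x}_1,\dots,A_m\mathbf{x}_m)$ from $\prod_{j=1}^m\mathbb{F}_{q_j}^l$ to $\mathbb{F}$ (vectors regarded as columns) is in $C^{[l]}$. The $(\mathbb{F},\mathbb{K})$-linearly closed clonoids form a lattice under inclusion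 (meet is intersection, join is the clonoid generated by the union). $\mathbb{K}^{\times}$ denotes the multiplicative monoid of the ring $\mathbb{K}$ (all elements of $\mathbb{K}$, including $0$ and zero divisors, with component-wise multiplication). For a commutative ring $R$ and commutative monoid $M$, $R[M]$ is the monoid ring: finitely supported functions $M\to R$ with point-wise addition and convolution product $(f\cdot g)(m)=\sum_{m_1m_2=m}f(m_1)g(m_2)$; $\tau_a$ is the element with value $1$ at $a$ and $0$ elsewhere. $R^M$ is an $R[M]$-module via the $R$-linear extension of $(\tau_a\ast f)(x)=f(ax)$, for $a\in M$, $f\in R^M$. This is applied with $R=\mathbb{F}_{p_i}$ and $M=\mathbb{K}^{\times}$. Submodules are ordered by inclusion. *)

theory Defs
  imports "HOL-Algebra.Algebra"
begin

section \<open>Products of rings\<close>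

definition prod_ring :: "'i set \<Rightarrow> ('i \<Rightarrow> ('a, 'c) ring_scheme) \<Rightarrow> ('i \<Rightarrow> 'a) ring" where
  "prod_ring I R = monoid.extend (product_group I R)
     (ring.fields (\<lambda>i\<in>I. \<zero>\<^bsub>R i\<^esub>) (\<lambda>x y. \<lambda>i\<in>I. x i \<oplus>\<^bsub>R i\<^esub> y i))"

lemma prod_ring_simps [simp]:
  "carrier (prod_ring I R) = (\<Pi>\<^sub>E i\<in>I. carrier (R i))"
  "x \<otimes>\<^bsub>prod_ring I R\<^esub> y = (\<lambda>i\<in>I. x i \<otimes>\<^bsub>R i\<^esub> y i)"
  "\<one>\<^bsub>prod_ring I R\<^esub> = (\<lambda>i\<in>I. \<one>\<^bsub>R i\<^esub>)"
  "\<zero>\<^bsub>prod_ring I R\<^esub> = (\<lambda>i\<in>I. \<zero>\<^bsub>R i\<^esub>)"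
  "x \<oplus>\<^bsub>prod_ring I R\<^esub> y = (\<lambda>i\<in>I. x i \<oplus>\<^bsub>R i\<^esub> y i)"
  by (simp_all add: prod_ring_def product_group_def monoid.defs ring.defs)


section \<open>Linearly closed clonoids\<close>

text \<open>
  The codomain is the product of the rings \<open>F i\<close> with \<open>i \<in> I\<close>, the domain of a \<open>k\<close>-ary function
  is the product over \<open>j \<in> J\<close> of the \<open>k\<close>-th powers of the rings \<open>K j\<close>.  An argument \<open>x\<close> is a
  family of vectors: \<open>x j r\<close> is the entry number \<open>r \<in> {1..k}\<close> of the \<open>j\<close>-th vector.  All tuples
  and functions are extensional, so that HOL equality is equality of the mathematical objects.
\<close>

definition args :: "'j set \<Rightarrow> ('j \<Rightarrow> ('a, 'c) ring_scheme) \<Rightarrow> nat \<Rightarrow> ('j \<Rightarrow> nat \<Rightarrow> 'a) set" where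
  "args J K k = (\<Pi>\<^sub>E j\<in>J. \<Pi>\<^sub>E r\<in>{1..k}. carrier (K j))"

definition kary_functions ::
  "'i set \<Rightarrow> ('i \<Rightarrow> ('b, 'd) ring_scheme) \<Rightarrow> 'j set \<Rightarrow> ('j \<Rightarrow> ('a, 'c) ring_scheme) \<Rightarrow> nat
    \<Rightarrow> (('j \<Rightarrow> nat \<Rightarrow> 'a) \<Rightarrow> ('i \<Rightarrow> 'b)) set" where
  "kary_functions I F J K k = args J K k \<rightarrow>\<^sub>E carrier (prod_ring I F)"

text \<open>Families \<open>(A\<^sub>j)\<close> of \<open>n \<times> l\<close> matrices, one over each \<open>K j\<close>; \<open>A j r c\<close> is the entry in row \<open>r\<close>
  and column \<open>c\<close> of \<open>A\<^sub>j\<close>.\<close>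

definition mats ::
  "'j set \<Rightarrow> ('j \<Rightarrow> ('a, 'c) ring_scheme) \<Rightarrow> nat \<Rightarrow> nat \<Rightarrow> ('j \<Rightarrow> nat \<Rightarrow> nat \<Rightarrow> 'a) set" where
  "mats J K n l = (\<Pi>\<^sub>E j\<in>J. \<Pi>\<^sub>E r\<in>{1..n}. \<Pi>\<^sub>E c\<in>{1..l}. carrier (K j))"

definition mats_apply ::
  "'j set \<Rightarrow> ('j \<Rightarrow> ('a, 'c) ring_scheme) \<Rightarrow> nat \<Rightarrow> nat \<Rightarrow> ('j \<Rightarrow> nat \<Rightarrow> nat \<Rightarrow> 'a)
    \<Rightarrow> ('j \<Rightarrow> nat \<Rightarrow> 'a) \<Rightarrow> ('j \<Rightarrow> nat \<Rightarrow> 'a)" where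
  "mats_apply J K n l A x =
     (\<lambda>j\<in>J. \<lambda>r\<in>{1..n}. \<Oplus>\<^bsub>K j\<^esub>c\<in>{1..l}. A j r c \<otimes>\<^bsub>K j\<^esub> x j c)"

text \<open>A set of functions of various arities is a set of pairs (arity, function), since the arity
  of an extensional function is not recoverable from its HOL type.\<close>

definition kary_part :: "(nat \<times> 'f) set \<Rightarrow> nat \<Rightarrow> 'f set" where
  "kary_part C k = {f. (k, f) \<in> C}"

definition linearly_closed_clonoid ::
  "'i set \<Rightarrow> ('i \<Rightarrow> ('b, 'd) ring_scheme) \<Rightarrow> 'j set \<Rightarrow> ('j \<Rightarrow> ('a, 'c) ring_scheme)
    \<Rightarrow> (nat \<times> (('j \<Rightarrow> nat \<Rightarrow> 'a) \<Rightarrow> ('i \<Rightarrow> 'b))) set \<Rightarrow> bool" where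
  "linearly_closed_clonoid I F J K C \<longleftrightarrow>
     C \<noteq> {} \<and>
     C \<subseteq> (SIGMA k:{1..}. kary_functions I F J K k) \<and>
     (\<forall>n\<ge>1. \<forall>a\<in>carrier (prod_ring I F). \<forall>b\<in>carrier (prod_ring I F).
        \<forall>f\<in>kary_part C n. \<forall>g\<in>kary_part C n.
          (\<lambda>x\<in>args J K n. a \<otimes>\<^bsub>prod_ring I F\<^esub> f x \<oplus>\<^bsub>prod_ring I F\<^esub> b \<otimes>\<^bsub>prod_ring I F\<^esub> g x)
            \<in> kary_part C n) \<and>
     (\<forall>l\<ge>1. \<forall>n\<ge>1. \<forall>f\<in>kary_part C n. \<forall>A\<in>mats J K n l.
          (\<lambda>x\<in>args J K l. f (mats_apply J K n l A x)) \<in> kary_part C l)"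

definition clonoid_lattice ::
  "'i set \<Rightarrow> ('i \<Rightarrow> ('b, 'd) ring_scheme) \<Rightarrow> 'j set \<Rightarrow> ('j \<Rightarrow> ('a, 'c) ring_scheme)
    \<Rightarrow> (nat \<times> (('j \<Rightarrow> nat \<Rightarrow> 'a) \<Rightarrow> ('i \<Rightarrow> 'b))) set gorder" where
  "clonoid_lattice I F J K =
     \<lparr>carrier = {C. linearly_closed_clonoid I F J K C}, eq = (=), le = (\<subseteq>)\<rparr>"


section \<open>The monoid ring \<open>R[M]\<close> and its action on \<open>R\<^sup>M\<close>\<close>

definition monoid_ring_tau ::
  "('r, 'x) ring_scheme \<Rightarrow> ('m, 'y) monoid_scheme \<Rightarrow> 'm \<Rightarrow> ('m \<Rightarrow> 'r)" where
  "monoid_ring_tau R M a = (\<lambda>x\<in>carrier M. if x = a then \<one>\<^bsub>R\<^esub> else \<zero>\<^bsub>R\<^esub>)"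

definition monoid_ring_support ::
  "('r, 'x) ring_scheme \<Rightarrow> ('m, 'y) monoid_scheme \<Rightarrow> ('m \<Rightarrow> 'r) \<Rightarrow> 'm set" where
  "monoid_ring_support R M f = {a \<in> carrier M. f a \<noteq> \<zero>\<^bsub>R\<^esub>}"

text \<open>\<^const>\<open>finsum\<close> is only meaningful over finite index sets, so the sums defining the convolution
  product and the action are restricted to the supports.\<close>

definition monoid_ring ::
  "('r, 'x) ring_scheme \<Rightarrow> ('m, 'y) monoid_scheme \<Rightarrow> ('m \<Rightarrow> 'r) ring" where
  "monoid_ring R M =
     \<lparr>carrier = {f \<in> carrier M \<rightarrow>\<^sub>E carrier R. finite (monoid_ring_support R M f)},
      monoid.mult = (\<lambda>f g. \<lambda>c\<in>carrier M.
        \<Oplus>\<^bsub>R\<^esub>p\<in>{p \<in> monoid_ring_support R M f \<times> monoid_ring_support R M g. fst p \<otimes>\<^bsub>M\<^esub> snd p = c}.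
          f (fst p) \<otimes>\<^bsub>R\<^esub> g (snd p)),
      monoid.one = monoid_ring_tau R M \<one>\<^bsub>M\<^esub>,
      ring.zero = (\<lambda>x\<in>carrier M. \<zero>\<^bsub>R\<^esub>),
      ring.add = (\<lambda>f g. \<lambda>x\<in>carrier M. f x \<oplus>\<^bsub>R\<^esub> g x)\<rparr>"

text \<open>The \<open>mult\<close> and \<open>one\<close> fields are forced by the record type and play no role for modules.\<close>

definition function_module ::
  "('r, 'x) ring_scheme \<Rightarrow> ('m, 'y) monoid_scheme \<Rightarrow> ('m \<Rightarrow> 'r, 'm \<Rightarrow> 'r) module" where
  "function_module R M =
     \<lparr>carrier = carrier M \<rightarrow>\<^sub>E carrier R,
      monoid.mult = (\<lambda>f g. \<lambda>x\<in>carrier M. f x \<otimes>\<^bsub>R\<^esub> g x),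
      monoid.one = (\<lambda>x\<in>carrier M. \<one>\<^bsub>R\<^esub>),
      ring.zero = (\<lambda>x\<in>carrier M. \<zero>\<^bsub>R\<^esub>),
      ring.add = (\<lambda>f g. \<lambda>x\<in>carrier M. f x \<oplus>\<^bsub>R\<^esub> g x),
      module.smult = (\<lambda>\<phi> f. \<lambda>x\<in>carrier M.
        \<Oplus>\<^bsub>R\<^esub>a\<in>monoid_ring_support R M \<phi>. \<phi> a \<otimes>\<^bsub>R\<^esub> f (a \<otimes>\<^bsub>M\<^esub> x))\<rparr>"

lemma tau_smult:
  assumes "cring R" "comm_monoid M" "\<one>\<^bsub>R\<^esub> \<noteq> \<zero>\<^bsub>R\<^esub>" "a \<in> carrier M" "f \<in> carrier M \<rightarrow>\<^sub>E carrier R"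
  shows "monoid_ring_tau R M a \<odot>\<^bsub>function_module R M\<^esub> f = (\<lambda>x\<in>carrier M. f (a \<otimes>\<^bsub>M\<^esub> x))"
proof -
  interpret R: cring R by fact
  interpret M: comm_monoid M by fact
  have s: "monoid_ring_support R M (monoid_ring_tau R M a) = {a}"
    using assms(3,4) by (auto simp: monoid_ring_support_def monoid_ring_tau_def)
  have c: "f (a \<otimes>\<^bsub>M\<^esub> x) \<in> carrier R" if "x \<in> carrier M" for x
    using PiE_mem[OF assms(5)] that assms(4) by blast
  have "(\<Oplus>\<^bsub>R\<^esub>b\<in>{a}. monoid_ring_tau R M a b \<otimes>\<^bsub>R\<^esub> f (b \<otimes>\<^bsub>M\<^esub> x)) = f (a \<otimes>\<^bsub>M\<^esub> x)"
    if "x \<in> carrier M" for x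
    using c[OF that] assms(4)
    by (subst R.finsum_insert) (auto simp: monoid_ring_tau_def)
  then show ?thesis
    unfolding function_module_def by (auto simp: s intro!: restrict_ext)
qed

definition submodule_lattice ::
  "('r, 'x) ring_scheme \<Rightarrow> ('m, 'y) monoid_scheme \<Rightarrow> ('m \<Rightarrow> 'r) set gorder" where
  "submodule_lattice R M =
     \<lparr>carrier = {V. submodule V (monoid_ring R M) (function_module R M)}, eq = (=), le = (\<subseteq>)\<rparr>"


section \<open>Direct products and isomorphisms of lattices\<close>

definition prod_order :: "'i set \<Rightarrow> ('i \<Rightarrow> ('a, 'c) gorder_scheme) \<Rightarrow> ('i \<Rightarrow> 'a) gorder" where
  "prod_order I L =
     \<lparr>carrier = (\<Pi>\<^sub>E i\<in>I. carrier (L i)), eq = (=), le = (\<lambda>x y. \<forall>i\<in>I. x i \<sqsubseteq>\<^bsub>L i\<^esub> y i)\<rparr>"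

text \<open>\<^const>\<open>join_pres\<close> and \<^const>\<open>meet_pres\<close> include that both orders are lattices.\<close>

definition lattice_iso ::
  "('a \<Rightarrow> 'b) \<Rightarrow> ('a, 'c) gorder_scheme \<Rightarrow> ('b, 'd) gorder_scheme \<Rightarrow> bool" where
  "lattice_iso h L L' \<longleftrightarrow>
     bij_betw h (carrier L) (carrier L') \<and> join_pres L L' h \<and> meet_pres L L' h"


section \<open>The unary part as a tuple of sets of functions\<close>

text \<open>Identification of the product of the \<open>K j\<close> with the product of their first powers, the domain
  of the unary functions.\<close>

definition unary_arg :: "'j set \<Rightarrow> ('j \<Rightarrow> 'a) \<Rightarrow> ('j \<Rightarrow> nat \<Rightarrow> 'a)" where
  "unary_arg J x = (\<lambda>j\<in>J. \<lambda>r\<in>{1..1}. x j)"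

lemma bij_betw_unary_arg:
  "bij_betw (unary_arg J) (carrier (prod_ring J K)) (args J K 1)"
  by (rule bij_betwI[where g = "\<lambda>y. \<lambda>j\<in>J. y j 1"])
     (fastforce simp: unary_arg_def args_def PiE_iff extensional_def fun_eq_iff restrict_def)+

definition unary_part ::
  "'i set \<Rightarrow> 'j set \<Rightarrow> ('j \<Rightarrow> ('a, 'c) ring_scheme)
    \<Rightarrow> (nat \<times> (('j \<Rightarrow> nat \<Rightarrow> 'a) \<Rightarrow> ('i \<Rightarrow> 'b))) set \<Rightarrow> ('i \<Rightarrow> (('j \<Rightarrow> 'a) \<Rightarrow> 'b) set)" where
  "unary_part I J K C =
     (\<lambda>i\<in>I. {(\<lambda>x\<in>carrier (prod_ring J K). f (unary_arg J x) i) | f. f \<in> kary_part C 1})"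

end

theory Submission
  imports Defs "HOL-Number_Theory.Cong"
begin

text \<open>Write \<open>K\<close> and \<open>F\<close> for the two product rings.  A tuple \<open>V\<close> of submodules has a largest clonoid with
  unary part \<open>V\<close>: a \<open>k\<close>-ary \<open>f\<close> belongs to it if every unary function \<open>x \<mapsto> f (b x)\<close>, with \<open>b\<close> a column
  over \<open>K\<close>, has its \<open>i\<close>-th component in \<open>V i\<close> (\<open>clonoid_of\<close>).  Passing to this clonoid and taking the
  unary part are both monotone, and taking the unary part recovers \<open>V\<close> (\<open>unary_part_clonoid_of\<close>).  So
  the theorem amounts to the statement that a clonoid \<open>C\<close> is determined by its unary part: if all
  unary functions \<open>x \<mapsto> f (b x)\<close> belong to \<open>C\<close>, so does \<open>f\<close> (\<open>clonoid_of_unary_part\<close>).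

  Together with such a unary function, \<open>C\<close> contains \<open>y \<mapsto> f (b (a \<cdot> y))\<close> for every row \<open>a\<close>, that is, the
  composition of \<open>f\<close> with every matrix of rank at most one.  Over a single field whose order is
  invertible in \<open>F\<close>, the identity operator on functions is a linear combination of compositions with
  such matrices (\<open>rank_one_interpolation\<close>): for each line through \<open>0\<close>, a difference of two sums over
  rows reproduces a multiple of \<open>f - f(0)\<close> on this line and vanishes elsewhere, and the multiple can
  be divided out because the orders of \<open>K\<close> and \<open>F\<close> are coprime.  For a product of fields the factors
  are treated one after the other (\<open>kary_mem_if_rank_one_mem\<close>).

  An order isomorphism transports joins and meets, and the clonoids form a lattice because they are
  closed under intersection.\<close>

section \<open>Order isomorphisms preserve joins and meets\<close>

lemma lattice_iso_if_order_iso: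
  assumes L: "lattice L" and L': "partial_order L'"
    and bij: "bij_betw h (carrier L) (carrier L')"
    and le_iff: "\<And>x y. x \<in> carrier L \<Longrightarrow> y \<in> carrier L \<Longrightarrow> h x \<sqsubseteq>\<^bsub>L'\<^esub> h y \<longleftrightarrow> x \<sqsubseteq>\<^bsub>L\<^esub> y"
  shows "lattice_iso h L L'"
proof -
  interpret L: lattice L by fact
  interpret L': partial_order L' by fact
  have carrier_eq: "carrier L' = h ` carrier L"
    using bij by (simp add: bij_betw_def)
  have lub: "least L' (h z) (Upper L' {h x, h y})"
    if "x \<in> carrier L" "y \<in> carrier L" "least L z (Upper L {x, y})" for x y z
    using that le_iff unfolding least_def Upper_def carrier_eq by auto
  have glb: "greatest L' (h z) (Lower L' {h x, h y})"
    if "x \<in> carrier L" "y \<in> carrier L" "greatest L z (Lower L {x, y})" for x y z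
    using that le_iff unfolding greatest_def Lower_def carrier_eq by auto
  have lub_join: "least L (x \<squnion>\<^bsub>L\<^esub> y) (Upper L {x, y})"
    if "x \<in> carrier L" "y \<in> carrier L" for x y
    unfolding join_def sup_def using L.sup_of_two_exists[OF that] by (rule someI_ex)
  have glb_meet: "greatest L (x \<sqinter>\<^bsub>L\<^esub> y) (Lower L {x, y})"
    if "x \<in> carrier L" "y \<in> carrier L" for x y
    unfolding meet_def inf_def using L.inf_of_two_exists[OF that] by (rule someI_ex)
  have "lattice L'"
    by (unfold_locales; unfold carrier_eq) (blast dest: lub[OF _ _ lub_join] glb[OF _ _ glb_meet])+
  moreover have "h (x \<squnion>\<^bsub>L\<^esub> y) = h x \<squnion>\<^bsub>L'\<^esub> h y" if "x \<in> carrier L" "y \<in> carrier L" for x y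
    unfolding join_def[of L'] sup_def
    by (rule L'.least_unique[OF lub[OF that lub_join[OF that]]],
        rule someI[of "\<lambda>z. least L' z (Upper L' {h x, h y})"], rule lub[OF that lub_join[OF that]])
  moreover have "h (x \<sqinter>\<^bsub>L\<^esub> y) = h x \<sqinter>\<^bsub>L'\<^esub> h y" if "x \<in> carrier L" "y \<in> carrier L" for x y
    unfolding meet_def[of L'] inf_def
    by (rule L'.greatest_unique[OF glb[OF that glb_meet[OF that]]],
        rule someI[of "\<lambda>z. greatest L' z (Lower L' {h x, h y})"], rule glb[OF that glb_meet[OF that]])
  ultimately show ?thesis
    using bij L by (simp add: lattice_iso_def join_pres_def meet_pres_def)
qed

section \<open>Products of commutative rings\<close>

lemma cring_prod_ring:
  assumes "\<And>i. i \<in> I \<Longrightarrow> cring (R i)"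
  shows "cring (prod_ring I R)"
proof -
  have [simp]: "abelian_group (R i)" if "i \<in> I" for i
    using assms[OF that] by (simp add: cring_def ring_def)
  have [simp]: "monoid (R i)" if "i \<in> I" for i
    using assms[OF that] by (simp add: cring_def ring_def)
  note simps = cring.cring_simprules[OF assms]
  have ab: "abelian_group (prod_ring I R)"
  proof (rule abelian_groupI)
    fix x assume x: "x \<in> carrier (prod_ring I R)"
    show "\<exists>y\<in>carrier (prod_ring I R). y \<oplus>\<^bsub>prod_ring I R\<^esub> x = \<zero>\<^bsub>prod_ring I R\<^esub>"
      by (rule bexI[where x = "\<lambda>i\<in>I. \<ominus>\<^bsub>R i\<^esub> x i"])
        (use x in \<open>auto simp: simps PiE_iff abelian_group.l_neg abelian_group.a_inv_closed intro!: restrict_ext\<close>)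
  qed (auto simp: simps PiE_mem fun_eq_iff PiE_iff extensional_def restrict_def)
  show ?thesis
    by (rule cringI[OF ab comm_monoidI])
      (auto simp: simps PiE_mem fun_eq_iff PiE_iff extensional_def restrict_def monoid.r_one)
qed

section \<open>Additive groups of functions\<close>

text \<open>The common structure of the \<open>k\<close>-ary part of a clonoid and of a submodule of a function space, in
  which sums of functions can be formed and multiples divided out.\<close>

locale function_subgroup = abelian_group G for G (structure) +
  fixes D :: "'x set" and W :: "('x \<Rightarrow> 'a) set"
  assumes subset: "W \<subseteq> D \<rightarrow>\<^sub>E carrier G"
    and zero_mem: "(\<lambda>x\<in>D. \<zero>) \<in> W"
    and minus_mem: "f \<in> W \<Longrightarrow> g \<in> W \<Longrightarrow> (\<lambda>x\<in>D. f x \<ominus> g x) \<in> W"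
begin

lemma mem_carrier: "f \<in> W \<Longrightarrow> x \<in> D \<Longrightarrow> f x \<in> carrier G"
  using subset by blast

lemma add_mem:
  assumes "f \<in> W" "g \<in> W"
  shows "(\<lambda>x\<in>D. f x \<oplus> g x) \<in> W"
proof -
  have "(\<lambda>x\<in>D. f x \<ominus> (\<lambda>x\<in>D. (\<lambda>x\<in>D. \<zero>) x \<ominus> g x) x) \<in> W"
    by (intro minus_mem zero_mem assms)
  also have "(\<lambda>x\<in>D. f x \<ominus> (\<lambda>x\<in>D. (\<lambda>x\<in>D. \<zero>) x \<ominus> g x) x) = (\<lambda>x\<in>D. f x \<oplus> g x)"
    by (rule restrict_ext) (use assms in \<open>simp add: mem_carrier minus_eq\<close>)
  finally show ?thesis .
qed

lemma finsum_mem: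
  assumes "finite S" "\<And>a. a \<in> S \<Longrightarrow> (\<lambda>x\<in>D. h a x) \<in> W"
  shows "(\<lambda>x\<in>D. \<Oplus>a\<in>S. h a x) \<in> W"
  using assms
proof (induction S rule: finite_induct)
  case empty
  then show ?case using zero_mem by (simp only: finsum_empty)
next
  case (insert a S)
  have c: "h b x \<in> carrier G" if "b \<in> insert a S" "x \<in> D" for b x
    using mem_carrier[OF insert.prems[OF that(1)] that(2)] that by simp
  have "(\<lambda>x\<in>D. (\<lambda>x\<in>D. h a x) x \<oplus> (\<lambda>x\<in>D. \<Oplus>a\<in>S. h a x) x) \<in> W"
    by (intro add_mem insert) auto
  also have "(\<lambda>x\<in>D. (\<lambda>x\<in>D. h a x) x \<oplus> (\<lambda>x\<in>D. \<Oplus>a\<in>S. h a x) x) = (\<lambda>x\<in>D. \<Oplus>a\<in>insert a S. h a x)"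
    by (rule restrict_ext) (use insert.hyps c in \<open>simp add: finsum_insert Pi_def\<close>)
  finally show ?case .
qed

text \<open>In an abelian group of order coprime to \<open>n\<close>, division by \<open>n\<close> is itself multiplication by a
  natural number, so a group of functions that contains \<open>n g\<close> contains \<open>g\<close>.  The coprimality of
  \<open>|K|\<close> and \<open>|F|\<close> enters the whole proof through this lemma only.\<close>

lemma mem_if_coprime_multiple_mem:
  assumes cop: "coprime n (card (carrier G))"
    and g: "g \<in> D \<rightarrow>\<^sub>E carrier G" and ng: "(\<lambda>x\<in>D. add_pow G n (g x)) \<in> W"
  shows "g \<in> W"
proof -
  obtain t where t: "[n * t = 1] (mod card (carrier G))"
    using cong_solve_coprime_nat[OF cop] by auto
  have ngx: "add_pow G n (g x) \<in> carrier G" if "x \<in> D" for x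
    using g that by (auto simp: PiE_mem)
  have cancel: "add_pow G t (add_pow G n y) = y" if y: "y \<in> carrier G" for y
  proof -
    have "add.ord y dvd card (carrier G)"
      using add.ord_dvd_group_order[OF y] by (simp add: order_def)
    moreover have "int (card (carrier G)) dvd 1 - int (n * t)"
      using t by (metis cong_iff_dvd_diff cong_int_iff cong_sym_eq of_nat_1)
    ultimately have ord_dvd: "int (add.ord y) dvd 1 - int (n * t)"
      by (meson dvd_trans int_dvd_int_iff)
    have "add_pow G t (add_pow G n y) = add_pow G (n * t) y"
      using y by (simp add: add.nat_pow_pow)
    also have "\<dots> = add_pow G (int (n * t)) y"
      by (simp only: add_pow_def int_pow_int)
    also have "\<dots> = add_pow G (1::int) y"
      using ord_dvd add.int_pow_eq[OF y] by blast
    also have "\<dots> = y"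
      using y by simp
    finally show ?thesis .
  qed
  have "(\<lambda>x\<in>D. \<Oplus>a\<in>{..<t}. add_pow G n (g x)) \<in> W"
    by (rule finsum_mem) (auto intro: ng)
  also have "(\<lambda>x\<in>D. \<Oplus>a\<in>{..<t}. add_pow G n (g x)) = (\<lambda>x\<in>D. g x)"
    by (rule restrict_ext) (simp add: add.finprod_const ngx cancel PiE_mem[OF g])
  also have "\<dots> = g"
    using g by (simp add: PiE_restrict)
  finally show ?thesis .
qed

end

section \<open>Interpolation by matrices of rank one\<close>

locale finite_field_vectors = field K for K (structure) +
  fixes N :: "'n set"
  assumes finite_index: "finite N" and finite_field: "finite (carrier K)"
begin

abbreviation vectors :: "('n \<Rightarrow> 'a) set" where
  "vectors \<equiv> N \<rightarrow>\<^sub>E carrier K"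

definition dot :: "('n \<Rightarrow> 'a) \<Rightarrow> ('n \<Rightarrow> 'a) \<Rightarrow> 'a" where
  "dot a x = (\<Oplus>r\<in>N. a r \<otimes> x r)"

definition scale :: "'a \<Rightarrow> ('n \<Rightarrow> 'a) \<Rightarrow> ('n \<Rightarrow> 'a)" where
  "scale c b = (\<lambda>r\<in>N. b r \<otimes> c)"

definition add_scaled :: "'a \<Rightarrow> ('n \<Rightarrow> 'a) \<Rightarrow> ('n \<Rightarrow> 'a) \<Rightarrow> ('n \<Rightarrow> 'a)" where
  "add_scaled c w a = (\<lambda>r\<in>N. a r \<oplus> w r \<otimes> c)"

definition unit_vector :: "'n \<Rightarrow> 'n \<Rightarrow> 'a" where
  "unit_vector r0 = (\<lambda>r\<in>N. if r = r0 then \<one> else \<zero>)"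

lemma vector_component [simp]: "a \<in> vectors \<Longrightarrow> r \<in> N \<Longrightarrow> a r \<in> carrier K"
  by (rule PiE_mem)

lemma vectors_closed [simp]:
  "x \<in> vectors \<Longrightarrow> a \<in> vectors \<Longrightarrow> dot a x \<in> carrier K"
  "b \<in> vectors \<Longrightarrow> c \<in> carrier K \<Longrightarrow> scale c b \<in> vectors"
  "w \<in> vectors \<Longrightarrow> a \<in> vectors \<Longrightarrow> c \<in> carrier K \<Longrightarrow> add_scaled c w a \<in> vectors"
  "unit_vector r0 \<in> vectors"
  by (auto simp: dot_def scale_def add_scaled_def unit_vector_def intro!: finsum_closed)

lemma finite_vectors: "finite vectors"
  using finite_index finite_field by (simp add: finite_PiE)

lemma dot_add_scaled:
  assumes "a \<in> vectors" "w \<in> vectors" "x \<in> vectors" "c \<in> carrier K"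
  shows "dot (add_scaled c w a) x = dot a x \<oplus> dot w x \<otimes> c"
proof -
  have "dot (add_scaled c w a) x = (\<Oplus>r\<in>N. a r \<otimes> x r \<oplus> (w r \<otimes> x r) \<otimes> c)"
    unfolding dot_def add_scaled_def
    by (rule finsum_cong') (use assms in \<open>simp_all add: r_distr m_ac\<close>)
  also have "\<dots> = dot a x \<oplus> (\<Oplus>r\<in>N. (w r \<otimes> x r) \<otimes> c)"
    unfolding dot_def by (rule finsum_addf) (use assms in \<open>simp_all add: Pi_def\<close>)
  also have "(\<Oplus>r\<in>N. (w r \<otimes> x r) \<otimes> c) = dot w x \<otimes> c"
    unfolding dot_def
    by (rule finsum_ldistr[symmetric]) (use assms finite_index in \<open>simp_all add: Pi_def\<close>)
  finally show ?thesis .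
qed

lemma dot_scale:
  assumes "a \<in> vectors" "b \<in> vectors" "c \<in> carrier K"
  shows "dot a (scale c b) = dot a b \<otimes> c"
proof -
  have "dot a (scale c b) = (\<Oplus>r\<in>N. (a r \<otimes> b r) \<otimes> c)"
    unfolding dot_def scale_def
    by (rule finsum_cong') (use assms in \<open>simp_all add: m_ac\<close>)
  also have "\<dots> = dot a b \<otimes> c"
    unfolding dot_def
    by (rule finsum_ldistr[symmetric]) (use assms finite_index in \<open>simp_all add: Pi_def\<close>)
  finally show ?thesis .
qed

lemma dot_unit_vector:
  assumes "x \<in> vectors" "r \<in> N"
  shows "dot (unit_vector r) x = x r"
proof -
  have "dot (unit_vector r) x = (\<Oplus>s\<in>N. if r = s then x s else \<zero>)"
    unfolding dot_def unit_vector_def by (rule finsum_cong') (use assms in simp_all)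
  then show ?thesis
    using finsum_singleton[of r N x] assms finite_index by (simp add: Pi_def)
qed

lemma add_scaled_inverse:
  assumes "a \<in> vectors" "w \<in> vectors" "c \<in> carrier K"
  shows "add_scaled (\<ominus> c) w (add_scaled c w a) = a"
  using assms
  by (auto simp: add_scaled_def fun_eq_iff a_assoc r_minus r_neg PiE_arb[OF assms(1)])

text \<open>The hypothesis says that the two-by-two minors of \<open>(x, b)\<close> through the row \<open>r0\<close> vanish.\<close>

lemma eq_scale_if_proportional:
  assumes "b \<in> vectors" "x \<in> vectors" "r0 \<in> N" "b r0 \<noteq> \<zero>"
    and "\<And>r. r \<in> N \<Longrightarrow> x r \<otimes> b r0 = b r \<otimes> x r0"
  shows "x = scale (x r0 \<otimes> inv (b r0)) b"
proof (rule ext)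
  fix r
  show "x r = scale (x r0 \<otimes> inv (b r0)) b r"
  proof (cases "r \<in> N")
    case True
    have u: "b r0 \<in> Units K" using assms by (simp add: field_Units)
    have "x r = (x r \<otimes> b r0) \<otimes> inv (b r0)"
      using True assms(1-4) u by (simp add: m_assoc)
    also have "\<dots> = (b r \<otimes> x r0) \<otimes> inv (b r0)"
      using assms(5)[OF True] by simp
    finally show ?thesis
      using True assms(1-4) u by (simp add: scale_def m_assoc)
  qed (simp add: scale_def PiE_arb[OF assms(2)])
qed

lemma ex_dual_one:
  assumes "b \<in> vectors" "r0 \<in> N" "b r0 \<noteq> \<zero>"
  shows "\<exists>w\<in>vectors. dot w b = \<one>"
proof -
  have u: "b r0 \<in> Units K" using assms by (simp add: field_Units)
  have z: "scale \<zero> b \<in> vectors" "dot (scale \<zero> b) b = \<zero>"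
    using assms by (auto simp: scale_def dot_def intro!: add.finprod_one_eqI)
  show ?thesis
    by (rule bexI[where x = "add_scaled (inv (b r0)) (unit_vector r0) (scale \<zero> b)"])
      (use assms u z in \<open>simp_all add: dot_add_scaled dot_unit_vector\<close>)
qed

text \<open>A vector \<open>x\<close> off the line of \<open>b\<close> has a nonzero two-by-two minor \<open>d\<close> with \<open>b\<close>; the minor with
  the column \<open>b\<close> replaced by a variable vector is a linear functional, and dividing it by \<open>d\<close> gives \<open>w\<close>.\<close>

lemma ex_separating_functional:
  assumes b: "b \<in> vectors" and x: "x \<in> vectors" and r0: "r0 \<in> N" "b r0 \<noteq> \<zero>"
    and off: "\<nexists>c. c \<in> carrier K \<and> x = scale c b"
  shows "\<exists>w\<in>vectors. dot w b = \<one> \<and> dot w x = \<zero>"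
proof -
  have "x r0 \<otimes> inv (b r0) \<in> carrier K" using b x r0 by (simp add: field_Units)
  then have "x \<noteq> scale (x r0 \<otimes> inv (b r0)) b" using off by blast
  then obtain r1 where r1: "r1 \<in> N" "x r1 \<otimes> b r0 \<noteq> b r1 \<otimes> x r0"
    using eq_scale_if_proportional[OF b x r0] by blast
  define d where "d = b r0 \<otimes> x r1 \<ominus> b r1 \<otimes> x r0"
  have d: "d \<in> Units K"
    using r1 r0 b x by (auto simp: d_def field_Units m_comm)
  define null where "null = scale \<zero> b"
  have null: "null \<in> vectors" "dot null b = \<zero>" "dot null x = \<zero>"
    using b x by (auto simp: null_def scale_def dot_def intro!: add.finprod_one_eqI)
  define w where "w = add_scaled (\<ominus> (x r0 \<otimes> inv d)) (unit_vector r1) (add_scaled (x r1 \<otimes> inv d) (unit_vector r0) null)"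
  have w_vec: "w \<in> vectors"
    using null d b x r0 r1 by (simp add: w_def)
  have "dot w x = x r0 \<otimes> (x r1 \<otimes> inv d) \<ominus> x r1 \<otimes> (x r0 \<otimes> inv d)"
    using null d b x r0 r1 by (simp add: w_def dot_add_scaled dot_unit_vector minus_eq r_minus)
  then have w_x: "dot w x = \<zero>"
    using d x r0 r1 by (simp add: m_lcomm r_right_minus_eq)
  have "dot w b = b r0 \<otimes> (x r1 \<otimes> inv d) \<ominus> b r1 \<otimes> (x r0 \<otimes> inv d)"
    using null d b x r0 r1 by (simp add: w_def dot_add_scaled dot_unit_vector minus_eq r_minus)
  also have "\<dots> = (b r0 \<otimes> x r1 \<ominus> b r1 \<otimes> x r0) \<otimes> inv d"
    using d b x r0 r1 by (simp add: minus_eq l_distr l_minus m_assoc)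
  also have "\<dots> = \<one>"
    unfolding d_def[symmetric] using d by (rule Units_r_inv)
  finally have w_b: "dot w b = \<one>" .
  show ?thesis using w_vec w_x w_b by blast
qed

definition fibre :: "('n \<Rightarrow> 'a) \<Rightarrow> 'a \<Rightarrow> ('n \<Rightarrow> 'a) set" where
  "fibre b c = {a \<in> vectors. dot a b = c}"

lemma finite_fibre: "finite (fibre b c)"
  using finite_vectors by (simp add: fibre_def)

text \<open>All fibres of \<open>a \<mapsto> dot a b\<close> are translates of one another.  For their cardinality any \<open>w\<close> with
  \<open>dot w b = 1\<close> serves; the freedom to choose \<open>w\<close> is what makes the sums in the interpolation
  argument cancel.\<close>

lemma bij_betw_fibre:
  assumes "b \<in> vectors" "w \<in> vectors" "dot w b = \<one>" "c \<in> carrier K" "d \<in> carrier K"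
  shows "bij_betw (add_scaled (d \<ominus> c) w) (fibre b c) (fibre b d)"
proof (rule bij_betwI)
  have e: "c \<oplus> (d \<ominus> c) = d" "d \<ominus> (d \<ominus> c) = c"
    using assms by (simp_all add: minus_eq a_lcomm[of c d] r_neg minus_add r_neg1 r_neg2)
  show "add_scaled (d \<ominus> c) w \<in> fibre b c \<rightarrow> fibre b d"
    using assms by (auto simp: fibre_def dot_add_scaled e)
  show "add_scaled (\<ominus> (d \<ominus> c)) w \<in> fibre b d \<rightarrow> fibre b c"
    using assms e by (auto simp: fibre_def dot_add_scaled minus_eq)
  show "add_scaled (\<ominus> (d \<ominus> c)) w (add_scaled (d \<ominus> c) w a) = a" if "a \<in> fibre b c" for a
    using that assms by (intro add_scaled_inverse) (auto simp: fibre_def)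
  show "add_scaled (d \<ominus> c) w (add_scaled (\<ominus> (d \<ominus> c)) w a) = a" if "a \<in> fibre b d" for a
    using that assms add_scaled_inverse[of a w "\<ominus> (d \<ominus> c)"] by (auto simp: fibre_def)
qed

lemma card_fibre_dvd:
  assumes b: "b \<in> vectors" and w: "w \<in> vectors" "dot w b = \<one>"
  shows "card (fibre b \<zero>) dvd card (carrier K) ^ card N"
proof -
  have "card (carrier K) ^ card N = card vectors"
    using finite_index by (simp add: card_PiE)
  also have "vectors = (\<Union>c\<in>carrier K. fibre b c)"
    using b by (auto simp: fibre_def)
  also have "card \<dots> = (\<Sum>c\<in>carrier K. card (fibre b c))"
    by (rule card_UN_disjoint) (auto simp: finite_field finite_fibre, auto simp: fibre_def)
  also have "\<dots> = (\<Sum>c\<in>carrier K. card (fibre b \<zero>))"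
    using bij_betw_same_card[OF bij_betw_fibre[OF b w zero_closed]] by (intro sum.cong) auto
  finally show ?thesis by simp
qed


text \<open>For a map \<open>f\<close> on vectors and a vector \<open>b \<noteq> 0\<close>, consider
    \<open>D_b(y) = (\<Sum>a | a \<cdot> b = 1. f(b (a \<cdot> y))) - (\<Sum>a | a \<cdot> b = 0. f(b (a \<cdot> y)))\<close>.
  If \<open>y\<close> lies on the line of \<open>b\<close>, then \<open>b (a \<cdot> y)\<close> equals \<open>y\<close> in the first sum and \<open>0\<close> in the second,
  so \<open>D_b(y) = n (f(y) - f(0))\<close>, where \<open>n\<close> is the common size of the fibres, a divisor of a power of
  \<open>|K|\<close>.  Otherwise some functional \<open>w\<close> has \<open>w \<cdot> b = 1\<close> and \<open>w \<cdot> y = 0\<close>, and translation by \<open>w\<close> matches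
  the two sums, so \<open>D_b(y) = 0\<close>.  After division by \<open>n\<close>, the function \<open>f - f(0)\<close> cut down to a single
  line is a combination of compositions of \<open>f\<close> with matrices of rank at most one, and adding up over
  all lines gives \<open>f - f(0)\<close> itself.

  The lemma has parameters: \<open>f\<close> may depend on \<open>x\<close>, and \<open>v x\<close> is the vector at which it is evaluated.
  This allows the argument to be applied to one factor of a product of fields at a time.\<close>

lemma rank_one_interpolation:
  fixes G :: "('g, 'm) ring_scheme" and D :: "'x set"
  assumes W: "function_subgroup G D W"
    and cop: "coprime (card (carrier K)) (card (carrier G))"
    and v: "\<And>x. x \<in> D \<Longrightarrow> v x \<in> vectors"
    and h: "\<And>x y. x \<in> D \<Longrightarrow> y \<in> vectors \<Longrightarrow> h x y \<in> carrier G"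
    and rank_one: "\<And>a b. a \<in> vectors \<Longrightarrow> b \<in> vectors \<Longrightarrow>
      (\<lambda>x\<in>D. h x (scale (dot a (v x)) b)) \<in> W"
  shows "(\<lambda>x\<in>D. h x (v x)) \<in> W"
proof -
  interpret W: function_subgroup G D W by fact
  define z where "z = (\<lambda>r\<in>N. \<zero>)"
  have z: "z \<in> vectors" by (simp add: z_def)
  have scale_z: "scale \<zero> b = z" if "b \<in> vectors" for b
    using that by (auto simp: scale_def z_def intro!: restrict_ext)
  have scale_of_z: "scale c z = z" if "c \<in> carrier K" for c
    using that by (auto simp: scale_def z_def intro!: restrict_ext)
  have dot_z: "dot a z = \<zero>" if "a \<in> vectors" for a
    using that by (auto simp: dot_def z_def intro!: add.finprod_one_eqI)
  define line where "line b = (\<lambda>c. scale c b) ` carrier K" for b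
  define part where "part S = (\<lambda>x\<in>D. if v x \<in> S then h x (v x) \<ominus>\<^bsub>G\<^esub> h x z else \<zero>\<^bsub>G\<^esub>)" for S
  have part_closed: "part S \<in> D \<rightarrow>\<^sub>E carrier G" for S
    using v h z by (auto simp: part_def)
  have part_line: "part (line b) \<in> W" if b: "b \<in> vectors" for b
  proof (cases "b = z")
    case True
    have "part (line b) = (\<lambda>x\<in>D. \<zero>\<^bsub>G\<^esub>)"
      unfolding part_def
      by (rule restrict_ext) (use h z in \<open>auto simp: True line_def scale_of_z W.minus_eq W.r_neg\<close>)
    then show ?thesis using W.zero_mem by (simp only:)
  next
    case False
    then obtain r0 where r0: "r0 \<in> N" "b r0 \<noteq> \<zero>"
      using PiE_ext[OF b z] by (auto simp: z_def)
    obtain w where w: "w \<in> vectors" "dot w b = \<one>"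
      using ex_dual_one[OF b r0] by blast
    define n where "n = card (fibre b \<zero>)"
    have n_one: "card (fibre b \<one>) = n"
      using bij_betw_same_card[OF bij_betw_fibre[OF b w zero_closed one_closed]] by (simp add: n_def)
    have "coprime (card (carrier K) ^ card N) (card (carrier G))"
      using cop by simp
    then have cop_n: "coprime n (card (carrier G))"
      unfolding n_def by (rule coprime_divisors[OF card_fibre_dvd[OF b w] dvd_refl])
    let ?s = "\<lambda>c x. \<Oplus>\<^bsub>G\<^esub>a\<in>fibre b c. h x (scale (dot a (v x)) b)"
    have closed: "h x (scale (dot a (v x)) b) \<in> carrier G" if "x \<in> D" "a \<in> fibre b c" for x a c
      using that(2) b by (intro h that(1) vectors_closed(2)) (auto simp: fibre_def v[OF that(1)])
    have sum_mem: "(\<lambda>x\<in>D. ?s c x) \<in> W" for c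
      by (rule W.finsum_mem[OF finite_fibre]) (auto simp: fibre_def intro!: rank_one b)
    have "(\<lambda>x\<in>D. (\<lambda>x\<in>D. ?s \<one> x) x \<ominus>\<^bsub>G\<^esub> (\<lambda>x\<in>D. ?s \<zero> x) x) \<in> W"
      by (intro W.minus_mem sum_mem)
    also have "(\<lambda>x\<in>D. (\<lambda>x\<in>D. ?s \<one> x) x \<ominus>\<^bsub>G\<^esub> (\<lambda>x\<in>D. ?s \<zero> x) x)
        = (\<lambda>x\<in>D. add_pow G n (part (line b) x))"
    proof (rule restrict_ext)
      fix x assume x: "x \<in> D"
      have "?s \<one> x \<ominus>\<^bsub>G\<^esub> ?s \<zero> x = add_pow G n (part (line b) x)"
      proof (cases "v x \<in> line b")
        case True
        then obtain c where c: "c \<in> carrier K" "v x = scale c b"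
          by (auto simp: line_def)
        have "?s d x = (\<Oplus>\<^bsub>G\<^esub>a\<in>fibre b d. h x (scale (d \<otimes> c) b))" if "d \<in> carrier K" for d
          by (rule W.finsum_cong')
            (use that x b c in \<open>auto simp: fibre_def dot_scale intro!: h vectors_closed(2)\<close>)
        then have s: "?s d x = add_pow G (card (fibre b d)) (h x (scale (d \<otimes> c) b))"
          if "d \<in> carrier K" for d
          using that x b c by (simp add: W.add.finprod_const h)
        show ?thesis
          using x c b z s[of \<one>] s[of \<zero>] True
          by (simp add: n_one n_def[symmetric] scale_z part_def h W.minus_eq W.add.nat_pow_inv
              W.add.nat_pow_distrib)
      next
        case False
        then have "\<nexists>c. c \<in> carrier K \<and> v x = scale c b"
          by (auto simp: line_def)
        then obtain w where w: "w \<in> vectors" "dot w b = \<one>" "dot w (v x) = \<zero>"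
          using ex_separating_functional[OF b v[OF x] r0] by blast
        let ?t = "add_scaled (\<one> \<ominus> \<zero>) w"
        have bij: "bij_betw ?t (fibre b \<zero>) (fibre b \<one>)"
          by (rule bij_betw_fibre[OF b w(1,2) zero_closed one_closed])
        have "?s \<one> x = (\<Oplus>\<^bsub>G\<^esub>a\<in>?t ` fibre b \<zero>. h x (scale (dot a (v x)) b))"
          using bij by (simp add: bij_betw_def)
        also have "\<dots> = (\<Oplus>\<^bsub>G\<^esub>a\<in>fibre b \<zero>. h x (scale (dot (?t a) (v x)) b))"
          by (rule W.finsum_reindex) (use bij closed[OF x] in \<open>auto simp: bij_betw_def\<close>)
        also have "\<dots> = ?s \<zero> x"
          by (rule W.finsum_cong')
            (use w x v closed[OF x] in \<open>auto simp: fibre_def dot_add_scaled\<close>)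
        finally show ?thesis
          using False x closed[OF x]
          by (simp add: part_def W.minus_eq W.r_neg W.finsum_closed Pi_def)
      qed
      then show "(\<lambda>x\<in>D. ?s \<one> x) x \<ominus>\<^bsub>G\<^esub> (\<lambda>x\<in>D. ?s \<zero> x) x = add_pow G n (part (line b) x)"
        using x by simp
    qed
    finally show ?thesis
      by (rule W.mem_if_coprime_multiple_mem[OF cop_n part_closed])
  qed
  \<comment> \<open>A line is contained in a given union of lines or meets it in \<open>0\<close> only, where \<open>h x - h x 0\<close>
    vanishes; hence a new line changes nothing or contributes additively.\<close>
  have "part (\<Union>b\<in>B. line b) \<in> W" if "finite B" "B \<subseteq> vectors" for B
    using that
  proof (induction B rule: finite_induct)
    case empty
    then show ?case using W.zero_mem by (simp only: part_def UN_empty empty_iff if_False)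
  next
    case (insert b B)
    let ?S = "\<Union>b\<in>B. line b"
    have b: "b \<in> vectors" and IH: "part ?S \<in> W" using insert by auto
    show ?case
    proof (cases "b \<in> ?S")
      case True
      then obtain b' c where b': "b' \<in> B" "c \<in> carrier K" "b = scale c b'"
        by (auto simp: line_def)
      have "scale d b = scale (c \<otimes> d) b'" if "d \<in> carrier K" for d
        using that b' insert by (auto simp: scale_def m_assoc intro!: restrict_ext)
      then have "line b \<subseteq> line b'"
        using b' by (auto simp: line_def)
      then have "(\<Union>b\<in>insert b B. line b) = ?S" using b' by auto
      then show ?thesis using IH by simp
    next
      case False
      have meet: "y = z" if y: "y \<in> line b" "y \<in> ?S" for y
      proof (rule ccontr)
        assume ne: "y \<noteq> z"
        obtain c where c: "c \<in> carrier K" "y = scale c b" using y by (auto simp: line_def)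
        obtain b' c' where b': "b' \<in> B" "c' \<in> carrier K" "y = scale c' b'"
          using y by (auto simp: line_def)
        have "c \<noteq> \<zero>" using ne c scale_z[OF b] by auto
        then have u: "c \<in> Units K" using c by (simp add: field_Units)
        have "b = scale (c' \<otimes> inv c) b'"
        proof (rule ext)
          fix r
          show "b r = scale (c' \<otimes> inv c) b' r"
          proof (cases "r \<in> N")
            case True
            have b'r: "b' r \<in> carrier K" using b' insert True by auto
            have "b r = (b r \<otimes> c) \<otimes> inv c" using True b c(1) u by (simp add: m_assoc)
            also have "b r \<otimes> c = b' r \<otimes> c'"
              using True c(2) b'(3) by (metis restrict_apply' scale_def)
            finally show ?thesis using True b'r b' u by (simp add: scale_def m_assoc)
          qed (simp add: scale_def PiE_arb[OF b])
        qed
        then show False using False b' u by (auto simp: line_def)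
      qed
      have "(\<lambda>x\<in>D. part ?S x \<oplus>\<^bsub>G\<^esub> part (line b) x) \<in> W"
        by (intro W.add_mem IH part_line b)
      also have "(\<lambda>x\<in>D. part ?S x \<oplus>\<^bsub>G\<^esub> part (line b) x) = part (\<Union>b\<in>insert b B. line b)"
        unfolding part_def[of "\<Union>b\<in>insert b B. line b"]
      proof (rule restrict_ext)
        fix x assume x: "x \<in> D"
        have "h x (v x) \<in> carrier G" "h x z \<in> carrier G" using x h v z by auto
        then show "part ?S x \<oplus>\<^bsub>G\<^esub> part (line b) x =
            (if v x \<in> (\<Union>b\<in>insert b B. line b) then h x (v x) \<ominus>\<^bsub>G\<^esub> h x z else \<zero>\<^bsub>G\<^esub>)"
          using x meet[of "v x"] by (auto simp: part_def W.minus_eq W.r_neg)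
      qed
      finally show ?thesis .
    qed
  qed
  then have "part (\<Union>b\<in>vectors. line b) \<in> W"
    using finite_vectors by blast
  moreover have "v x \<in> (\<Union>b\<in>vectors. line b)" if "x \<in> D" for x
  proof -
    have "scale \<one> (v x) = v x"
      using v[OF that] by (auto simp: scale_def PiE_arb[OF v[OF that]] fun_eq_iff)
    then show ?thesis using v[OF that] unfolding line_def by (metis UN_I image_eqI one_closed)
  qed
  moreover have "(\<lambda>x\<in>D. h x z) = (\<lambda>x\<in>D. h x (scale (dot z (v x)) z))"
    by (rule restrict_ext) (simp add: scale_of_z v z)
  then have "(\<lambda>x\<in>D. h x z) \<in> W"
    using rank_one[OF z z] by (simp only:)
  ultimately have "(\<lambda>x\<in>D. part (\<Union>b\<in>vectors. line b) x \<oplus>\<^bsub>G\<^esub> (\<lambda>x\<in>D. h x z) x) \<in> W"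
    by (intro W.add_mem)
  also have "(\<lambda>x\<in>D. part (\<Union>b\<in>vectors. line b) x \<oplus>\<^bsub>G\<^esub> (\<lambda>x\<in>D. h x z) x) = (\<lambda>x\<in>D. h x (v x))"
    by (rule restrict_ext)
      (use \<open>\<And>x. x \<in> D \<Longrightarrow> v x \<in> (\<Union>b\<in>vectors. line b)\<close> h v z in
        \<open>auto simp: part_def W.minus_eq W.a_assoc W.l_neg\<close>)
  finally show ?thesis .
qed

end

section \<open>Submodules of function spaces over a monoid ring\<close>

text \<open>The \<open>R[M]\<close>-submodules of \<open>R\<^sup>M\<close> in terms of the two kinds of operations that generate the
  action: linear combinations, and multiplications of the argument by elements of \<open>M\<close>.\<close>

definition scaling_closed_subspace ::
  "('r, 'x) ring_scheme \<Rightarrow> ('m, 'y) monoid_scheme \<Rightarrow> ('m \<Rightarrow> 'r) set \<Rightarrow> bool" where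
  "scaling_closed_subspace R M V \<longleftrightarrow>
     V \<subseteq> carrier M \<rightarrow>\<^sub>E carrier R \<and>
     (\<lambda>x\<in>carrier M. \<zero>\<^bsub>R\<^esub>) \<in> V \<and>
     (\<forall>c\<in>carrier R. \<forall>d\<in>carrier R. \<forall>f\<in>V. \<forall>g\<in>V.
        (\<lambda>x\<in>carrier M. c \<otimes>\<^bsub>R\<^esub> f x \<oplus>\<^bsub>R\<^esub> d \<otimes>\<^bsub>R\<^esub> g x) \<in> V) \<and>
     (\<forall>a\<in>carrier M. \<forall>f\<in>V. (\<lambda>x\<in>carrier M. f (a \<otimes>\<^bsub>M\<^esub> x)) \<in> V)"

text \<open>Scalars act as multiples of \<open>\<tau>\<^sub>1\<close> and multiplication of the argument by \<open>a\<close> is the action of \<open>\<tau>\<^sub>a\<close>; conversely every element of the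
  monoid ring is a finite linear combination of the \<open>\<tau>\<^sub>a\<close>.\<close>

lemma submodule_iff_scaling_closed_subspace:
  fixes R :: "('r, 'x) ring_scheme" and M :: "('m, 'y) monoid_scheme"
  assumes R: "cring R" and M: "comm_monoid M" and ne: "\<one>\<^bsub>R\<^esub> \<noteq> \<zero>\<^bsub>R\<^esub>"
  shows "submodule V (monoid_ring R M) (function_module R M) \<longleftrightarrow> scaling_closed_subspace R M V"
proof
  interpret R: cring R by fact
  interpret M: comm_monoid M by fact
  let ?FM = "function_module R M"
  assume V: "submodule V (monoid_ring R M) ?FM"
  interpret V: submodule V "monoid_ring R M" ?FM by fact
  have sub: "V \<subseteq> carrier M \<rightarrow>\<^sub>E carrier R"
    using V.subset by (simp add: function_module_def)
  have val: "f x \<in> carrier R" if "f \<in> V" "x \<in> carrier M" for f x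
    using sub that by auto
  have zero: "(\<lambda>x\<in>carrier M. \<zero>\<^bsub>R\<^esub>) \<in> V"
    using V.one_closed by (simp add: function_module_def)
  have add: "(\<lambda>x\<in>carrier M. f x \<oplus>\<^bsub>R\<^esub> g x) \<in> V" if "f \<in> V" "g \<in> V" for f g
    using V.m_closed[OF that] by (simp add: function_module_def)
  have smult: "(\<lambda>x\<in>carrier M. c \<otimes>\<^bsub>R\<^esub> f x) \<in> V" if c: "c \<in> carrier R" and f: "f \<in> V" for c f
  proof (cases "c = \<zero>\<^bsub>R\<^esub>")
    case True
    have "(\<lambda>x\<in>carrier M. c \<otimes>\<^bsub>R\<^esub> f x) = (\<lambda>x\<in>carrier M. \<zero>\<^bsub>R\<^esub>)"
      by (rule restrict_ext) (simp add: True val[OF f])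
    then show ?thesis using zero by (simp only:)
  next
    case False
    let ?p = "\<lambda>x\<in>carrier M. if x = \<one>\<^bsub>M\<^esub> then c else \<zero>\<^bsub>R\<^esub>"
    have supp: "monoid_ring_support R M ?p = {\<one>\<^bsub>M\<^esub>}"
      using False by (auto simp: monoid_ring_support_def)
    have "?p \<in> carrier (monoid_ring R M)"
      using c supp by (auto simp: monoid_ring_def)
    then have "?p \<odot>\<^bsub>?FM\<^esub> f \<in> V" using f by (rule V.smult_closed)
    also have "?p \<odot>\<^bsub>?FM\<^esub> f = (\<lambda>x\<in>carrier M. \<Oplus>\<^bsub>R\<^esub>a\<in>{\<one>\<^bsub>M\<^esub>}. ?p a \<otimes>\<^bsub>R\<^esub> f (a \<otimes>\<^bsub>M\<^esub> x))"
      by (simp add: function_module_def supp)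
    also have "\<dots> = (\<lambda>x\<in>carrier M. c \<otimes>\<^bsub>R\<^esub> f x)"
      by (rule restrict_ext) (simp add: R.finsum_insert val[OF f] c)
    finally show ?thesis .
  qed
  have lin: "(\<lambda>x\<in>carrier M. c \<otimes>\<^bsub>R\<^esub> f x \<oplus>\<^bsub>R\<^esub> d \<otimes>\<^bsub>R\<^esub> g x) \<in> V"
    if "c \<in> carrier R" "d \<in> carrier R" "f \<in> V" "g \<in> V" for c d f g
    using add[OF smult[OF that(1,3)] smult[OF that(2,4)]] by (simp cong: restrict_cong)
  have "(\<lambda>x\<in>carrier M. f (a \<otimes>\<^bsub>M\<^esub> x)) \<in> V" if a: "a \<in> carrier M" and f: "f \<in> V" for a f
  proof -
    have "monoid_ring_support R M (monoid_ring_tau R M a) \<subseteq> {a}"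
      by (auto simp: monoid_ring_support_def monoid_ring_tau_def split: if_splits)
    then have "finite (monoid_ring_support R M (monoid_ring_tau R M a))"
      by (rule finite_subset) simp
    then have "monoid_ring_tau R M a \<in> carrier (monoid_ring R M)"
      by (auto simp: monoid_ring_def monoid_ring_tau_def)
    then show ?thesis
      using V.smult_closed[OF _ f] tau_smult[OF R M ne a subsetD[OF sub f]] by metis
  qed
  then show "scaling_closed_subspace R M V"
    using sub zero lin by (simp add: scaling_closed_subspace_def)
next
  interpret R: cring R by fact
  interpret M: comm_monoid M by fact
  let ?FM = "function_module R M"
  assume "scaling_closed_subspace R M V"
  then have sub: "V \<subseteq> carrier M \<rightarrow>\<^sub>E carrier R"
    and zero: "(\<lambda>x\<in>carrier M. \<zero>\<^bsub>R\<^esub>) \<in> V"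
    and lin: "\<And>c d f g. c \<in> carrier R \<Longrightarrow> d \<in> carrier R \<Longrightarrow> f \<in> V \<Longrightarrow> g \<in> V \<Longrightarrow>
        (\<lambda>x\<in>carrier M. c \<otimes>\<^bsub>R\<^esub> f x \<oplus>\<^bsub>R\<^esub> d \<otimes>\<^bsub>R\<^esub> g x) \<in> V"
    and trans: "\<And>a f. a \<in> carrier M \<Longrightarrow> f \<in> V \<Longrightarrow> (\<lambda>x\<in>carrier M. f (a \<otimes>\<^bsub>M\<^esub> x)) \<in> V"
    by (auto simp: scaling_closed_subspace_def)
  have val: "f x \<in> carrier R" if "f \<in> V" "x \<in> carrier M" for f x
    using sub that by auto
  interpret W: function_subgroup R "carrier M" V
  proof
    fix f g assume fg: "f \<in> V" "g \<in> V"
    have "(\<lambda>x\<in>carrier M. f x \<ominus>\<^bsub>R\<^esub> g x)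
        = (\<lambda>x\<in>carrier M. \<one>\<^bsub>R\<^esub> \<otimes>\<^bsub>R\<^esub> f x \<oplus>\<^bsub>R\<^esub> (\<ominus>\<^bsub>R\<^esub> \<one>\<^bsub>R\<^esub>) \<otimes>\<^bsub>R\<^esub> g x)"
      by (rule restrict_ext) (use fg in \<open>simp add: val R.minus_eq R.l_minus\<close>)
    then show "(\<lambda>x\<in>carrier M. f x \<ominus>\<^bsub>R\<^esub> g x) \<in> V"
      using lin[of "\<one>\<^bsub>R\<^esub>" "\<ominus>\<^bsub>R\<^esub> \<one>\<^bsub>R\<^esub>" f g] fg by simp
  qed (use sub zero in auto)
  have group: "group (add_monoid ?FM)"
  proof (rule groupI)
    fix f assume "f \<in> carrier (add_monoid ?FM)"
    then show "\<exists>g\<in>carrier (add_monoid ?FM). g \<otimes>\<^bsub>add_monoid ?FM\<^esub> f = \<one>\<^bsub>add_monoid ?FM\<^esub>"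
      by (intro bexI[where x = "\<lambda>x\<in>carrier M. \<ominus>\<^bsub>R\<^esub> f x"])
        (auto simp: function_module_def PiE_iff R.l_neg intro!: restrict_ext)
  qed (auto simp: function_module_def PiE_iff R.a_assoc extensional_def fun_eq_iff)
  have inv: "inv\<^bsub>add_monoid ?FM\<^esub> f \<in> V" if f: "f \<in> V" for f
  proof -
    let ?g = "\<lambda>x\<in>carrier M. (\<lambda>x\<in>carrier M. \<zero>\<^bsub>R\<^esub>) x \<ominus>\<^bsub>R\<^esub> f x"
    have g: "?g \<in> V" by (rule W.minus_mem[OF zero f])
    have "inv\<^bsub>add_monoid ?FM\<^esub> f = ?g"
      by (rule group.inv_equality[OF group])
        (use f g sub val in \<open>auto simp: function_module_def R.minus_eq R.l_neg intro!: restrict_ext\<close>)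
    then show ?thesis using g by simp
  qed
  have smult: "p \<odot>\<^bsub>?FM\<^esub> f \<in> V" if p: "p \<in> carrier (monoid_ring R M)" and f: "f \<in> V" for p f
  proof -
    let ?S = "monoid_ring_support R M p"
    have S: "finite ?S" "?S \<subseteq> carrier M" "\<And>a. a \<in> ?S \<Longrightarrow> p a \<in> carrier R"
      using p by (auto simp: monoid_ring_def monoid_ring_support_def)
    have "(\<lambda>x\<in>carrier M. p a \<otimes>\<^bsub>R\<^esub> f (a \<otimes>\<^bsub>M\<^esub> x)) \<in> V" if a: "a \<in> ?S" for a
    proof -
      have t: "(\<lambda>x\<in>carrier M. f (a \<otimes>\<^bsub>M\<^esub> x)) \<in> V" using trans f a S by blast
      have "(\<lambda>x\<in>carrier M. p a \<otimes>\<^bsub>R\<^esub> (\<lambda>x\<in>carrier M. f (a \<otimes>\<^bsub>M\<^esub> x)) x \<oplus>\<^bsub>R\<^esub> \<zero>\<^bsub>R\<^esub> \<otimes>\<^bsub>R\<^esub> f x)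
          = (\<lambda>x\<in>carrier M. p a \<otimes>\<^bsub>R\<^esub> f (a \<otimes>\<^bsub>M\<^esub> x))"
        by (rule restrict_ext) (use S a f val in auto)
      then show ?thesis using lin[OF S(3)[OF a] R.zero_closed t f] by simp
    qed
    then have "(\<lambda>x\<in>carrier M. \<Oplus>\<^bsub>R\<^esub>a\<in>?S. p a \<otimes>\<^bsub>R\<^esub> f (a \<otimes>\<^bsub>M\<^esub> x)) \<in> V"
      by (rule W.finsum_mem[OF S(1)])
    then show ?thesis by (simp add: function_module_def)
  qed
  show "submodule V (monoid_ring R M) ?FM"
    by (unfold_locales; (rule inv smult)?)
      (use sub zero W.add_mem in \<open>auto simp: function_module_def\<close>)
qed

section \<open>Substitutions in clonoids\<close>

text \<open>The effect of a family of column matrices \<open>b\<close> on \<open>x\<close>, read as a map from \<open>K\<close> to \<open>K\<^sup>k\<close>, and of a family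
  of row matrices, read as a map from \<open>K\<^sup>k\<close> to \<open>K\<close>.  Every family of matrices of rank at most one
  factors as a row followed by a column, so composing with it passes through a unary function.\<close>

definition scale_args ::
  "'j set \<Rightarrow> ('j \<Rightarrow> ('a, 'c) ring_scheme) \<Rightarrow> nat \<Rightarrow> ('j \<Rightarrow> nat \<Rightarrow> 'a) \<Rightarrow> ('j \<Rightarrow> 'a) \<Rightarrow> ('j \<Rightarrow> nat \<Rightarrow> 'a)" where
  "scale_args J K k b x = (\<lambda>j\<in>J. \<lambda>r\<in>{1..k}. b j r \<otimes>\<^bsub>K j\<^esub> x j)"

definition dot_args ::
  "'j set \<Rightarrow> ('j \<Rightarrow> ('a, 'c) ring_scheme) \<Rightarrow> nat \<Rightarrow> ('j \<Rightarrow> nat \<Rightarrow> 'a) \<Rightarrow> ('j \<Rightarrow> nat \<Rightarrow> 'a) \<Rightarrow> ('j \<Rightarrow> 'a)" where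
  "dot_args J K k a x = (\<lambda>j\<in>J. \<Oplus>\<^bsub>K j\<^esub>c\<in>{1..k}. a j c \<otimes>\<^bsub>K j\<^esub> x j c)"

locale field_products =
  fixes I :: "'i set" and F :: "'i \<Rightarrow> ('b, 'd) ring_scheme"
    and J :: "'j set" and K :: "'j \<Rightarrow> ('a, 'c) ring_scheme"
  assumes finite_I: "finite I" and finite_J: "finite J"
    and field_F: "\<And>i. i \<in> I \<Longrightarrow> field (F i)"
    and field_K: "\<And>j. j \<in> J \<Longrightarrow> field (K j)"
    and finite_K: "\<And>j. j \<in> J \<Longrightarrow> finite (carrier (K j))"
begin

abbreviation "PF \<equiv> prod_ring I F"
abbreviation "PK \<equiv> prod_ring J K"
abbreviation "clonoid \<equiv> linearly_closed_clonoid I F J K"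

lemma cring_F: "i \<in> I \<Longrightarrow> cring (F i)"
  using field_F by (simp add: field.axioms(1) domain.axioms(1))

lemma cring_K: "j \<in> J \<Longrightarrow> cring (K j)"
  using field_K by (simp add: field.axioms(1) domain.axioms(1))

lemma field_vectors: "j \<in> J \<Longrightarrow> finite_field_vectors (K j) {1..k::nat}"
  using field_K finite_K by (simp add: finite_field_vectors_def finite_field_vectors_axioms_def)

sublocale PF: cring PF
  by (rule cring_prod_ring) (rule cring_F)

sublocale PK: cring PK
  by (rule cring_prod_ring) (rule cring_K)

lemma args_mem: "x \<in> args J K k \<Longrightarrow> j \<in> J \<Longrightarrow> x j \<in> {1..k} \<rightarrow>\<^sub>E carrier (K j)"
  unfolding args_def by (rule PiE_mem)

lemma args_entry: "x \<in> args J K k \<Longrightarrow> j \<in> J \<Longrightarrow> r \<in> {1..k} \<Longrightarrow> x j r \<in> carrier (K j)"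
  using args_mem by blast

lemma mats_row_mem: "A \<in> mats J K n l \<Longrightarrow> j \<in> J \<Longrightarrow> r \<in> {1..n} \<Longrightarrow> A j r \<in> {1..l} \<rightarrow>\<^sub>E carrier (K j)"
  unfolding mats_def by (drule PiE_mem, assumption, drule PiE_mem)

lemma PK_mem: "x \<in> carrier PK \<Longrightarrow> j \<in> J \<Longrightarrow> x j \<in> carrier (K j)"
  by auto

lemma unary_arg_closed [simp]: "x \<in> carrier PK \<Longrightarrow> unary_arg J x \<in> args J K 1"
  using bij_betw_apply[OF bij_betw_unary_arg] .

lemma scale_args_closed [simp]:
  assumes "b \<in> args J K k" "x \<in> carrier PK"
  shows "scale_args J K k b x \<in> args J K k"
  using args_entry[OF assms(1)] PK_mem[OF assms(2)] cring.cring_simprules(5)[OF cring_K]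
  by (auto simp: scale_args_def args_def)

lemma dot_args_closed [simp]:
  assumes "a \<in> args J K k" "x \<in> args J K k"
  shows "dot_args J K k a x \<in> carrier PK"
proof -
  have "(\<Oplus>\<^bsub>K j\<^esub>c\<in>{1..k}. a j c \<otimes>\<^bsub>K j\<^esub> x j c) \<in> carrier (K j)" if j: "j \<in> J" for j
  proof -
    interpret cring "K j" by (rule cring_K[OF j])
    show ?thesis using args_entry[OF assms(1) j] args_entry[OF assms(2) j]
      by (intro finsum_closed) auto
  qed
  then show ?thesis by (auto simp: dot_args_def)
qed

lemma mats_apply_closed [simp]:
  assumes "A \<in> mats J K n l" "x \<in> args J K l"
  shows "mats_apply J K n l A x \<in> args J K n"
proof -
  have "(\<Oplus>\<^bsub>K j\<^esub>c\<in>{1..l}. A j r c \<otimes>\<^bsub>K j\<^esub> x j c) \<in> carrier (K j)" if j: "j \<in> J" "r \<in> {1..n}" for j r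
  proof -
    interpret cring "K j" by (rule cring_K[OF j(1)])
    have "A j r \<in> {1..l} \<rightarrow>\<^sub>E carrier (K j)" by (rule mats_row_mem[OF assms(1) j])
    then show ?thesis using args_entry[OF assms(2) j(1)]
      by (intro finsum_closed) auto
  qed
  then show ?thesis by (auto simp: mats_apply_def args_def)
qed

lemma mats_apply_scale_args:
  assumes A: "A \<in> mats J K n l" and b: "b \<in> args J K l" and x: "x \<in> carrier PK"
  shows "mats_apply J K n l A (scale_args J K l b x) = scale_args J K n (mats_apply J K n l A b) x"
proof -
  have "(\<Oplus>\<^bsub>K j\<^esub>c\<in>{1..l}. A j r c \<otimes>\<^bsub>K j\<^esub> scale_args J K l b x j c)
      = (\<Oplus>\<^bsub>K j\<^esub>c\<in>{1..l}. A j r c \<otimes>\<^bsub>K j\<^esub> b j c) \<otimes>\<^bsub>K j\<^esub> x j" if j: "j \<in> J" "r \<in> {1..n}" for j r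
  proof -
    interpret cring "K j" by (rule cring_K[OF j(1)])
    have "A j r \<in> {1..l} \<rightarrow>\<^sub>E carrier (K j)" by (rule mats_row_mem[OF A j])
    then have e: "A j r c \<in> carrier (K j)" "b j c \<in> carrier (K j)" if "c \<in> {1..l}" for c
      using that args_entry[OF b j(1)] by auto
    have xj: "x j \<in> carrier (K j)" by (rule PK_mem[OF x j(1)])
    have "(\<Oplus>\<^bsub>K j\<^esub>c\<in>{1..l}. A j r c \<otimes>\<^bsub>K j\<^esub> scale_args J K l b x j c)
        = (\<Oplus>\<^bsub>K j\<^esub>c\<in>{1..l}. (A j r c \<otimes>\<^bsub>K j\<^esub> b j c) \<otimes>\<^bsub>K j\<^esub> x j)"
      by (rule finsum_cong') (use e xj j in \<open>simp_all add: scale_args_def m_assoc\<close>)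
    also have "\<dots> = (\<Oplus>\<^bsub>K j\<^esub>c\<in>{1..l}. A j r c \<otimes>\<^bsub>K j\<^esub> b j c) \<otimes>\<^bsub>K j\<^esub> x j"
      by (rule finsum_ldistr[symmetric]) (use e xj in auto)
    finally show ?thesis .
  qed
  then show ?thesis
    by (simp add: mats_apply_def scale_args_def cong: restrict_cong)
qed

lemma mats_apply_column:
  assumes b: "b \<in> args J K k" and x: "x \<in> carrier PK"
  shows "mats_apply J K k 1 (\<lambda>j\<in>J. \<lambda>r\<in>{1..k}. \<lambda>c\<in>{1..1}. b j r) (unary_arg J x) = scale_args J K k b x"
  unfolding mats_apply_def scale_args_def
proof (intro restrict_ext)
  fix j r assume j: "j \<in> J" "r \<in> {1..k}"
  interpret cring "K j" by (rule cring_K[OF j(1)])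
  show "(\<Oplus>\<^bsub>K j\<^esub>c\<in>{1..1}. (\<lambda>j\<in>J. \<lambda>r\<in>{1..k}. \<lambda>c\<in>{1..1}. b j r) j r c \<otimes>\<^bsub>K j\<^esub> unary_arg J x j c)
      = b j r \<otimes>\<^bsub>K j\<^esub> x j"
    using j args_entry[OF b j] PK_mem[OF x j(1)] by (simp add: unary_arg_def finsum_insert)
qed

lemma mats_apply_row:
  assumes a: "a \<in> args J K k" and x: "x \<in> args J K k"
  shows "mats_apply J K 1 k (\<lambda>j\<in>J. \<lambda>r\<in>{1..1}. \<lambda>c\<in>{1..k}. a j c) x = unary_arg J (dot_args J K k a x)"
proof -
  have "(\<Oplus>\<^bsub>K j\<^esub>c\<in>{1..k}. (\<lambda>c\<in>{1..k}. a j c) c \<otimes>\<^bsub>K j\<^esub> x j c) = (\<Oplus>\<^bsub>K j\<^esub>c\<in>{1..k}. a j c \<otimes>\<^bsub>K j\<^esub> x j c)"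
    if j: "j \<in> J" for j
  proof -
    interpret cring "K j" by (rule cring_K[OF j])
    show ?thesis
      by (rule finsum_cong') (use args_entry[OF a j] args_entry[OF x j] in auto)
  qed
  then show ?thesis
    by (simp add: mats_apply_def dot_args_def unary_arg_def cong: restrict_cong)
qed

lemma clonoid_subset: "clonoid C \<Longrightarrow> (k, f) \<in> C \<Longrightarrow> k \<ge> 1 \<and> f \<in> kary_functions I F J K k"
  by (auto simp: linearly_closed_clonoid_def)

lemma kary_value: "f \<in> kary_functions I F J K k \<Longrightarrow> x \<in> args J K k \<Longrightarrow> f x \<in> carrier PF"
  unfolding kary_functions_def by (rule PiE_mem[of f "args J K k" "\<lambda>_. carrier PF"])

lemma kary_component:
  "f \<in> kary_functions I F J K k \<Longrightarrow> x \<in> args J K k \<Longrightarrow> i \<in> I \<Longrightarrow> f x i \<in> carrier (F i)"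
  using kary_value by fastforce

lemma clonoid_lin:
  assumes "clonoid C" "k \<ge> 1" "a \<in> carrier PF" "b \<in> carrier PF" "f \<in> kary_part C k" "g \<in> kary_part C k"
  shows "(\<lambda>x\<in>args J K k. a \<otimes>\<^bsub>PF\<^esub> f x \<oplus>\<^bsub>PF\<^esub> b \<otimes>\<^bsub>PF\<^esub> g x) \<in> kary_part C k"
  using assms unfolding linearly_closed_clonoid_def by blast

lemma clonoid_subst:
  assumes "clonoid C" "l \<ge> 1" "n \<ge> 1" "f \<in> kary_part C n" "A \<in> mats J K n l"
  shows "(\<lambda>x\<in>args J K l. f (mats_apply J K n l A x)) \<in> kary_part C l"
  using assms unfolding linearly_closed_clonoid_def by blast

lemma column_mats:
  assumes "b \<in> args J K k"
  shows "(\<lambda>j\<in>J. \<lambda>r\<in>{1..k}. \<lambda>c\<in>{1..l}. b j r) \<in> mats J K k l"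
  using args_entry[OF assms] by (auto simp: mats_def)

lemma row_mats:
  assumes "a \<in> args J K k"
  shows "(\<lambda>j\<in>J. \<lambda>r\<in>{1..l}. \<lambda>c\<in>{1..k}. a j c) \<in> mats J K l k"
  using args_entry[OF assms] by (auto simp: mats_def)

lemma clonoid_subst_column:
  assumes C: "clonoid C" and k: "k \<ge> 1" and f: "f \<in> kary_part C k" and b: "b \<in> args J K k"
  shows "\<exists>g\<in>kary_part C 1. \<forall>x\<in>carrier PK. g (unary_arg J x) = f (scale_args J K k b x)"
proof (rule bexI[OF ballI clonoid_subst[OF C order_refl k f column_mats[OF b]]])
  fix x assume "x \<in> carrier PK"
  then show "(\<lambda>y\<in>args J K 1. f (mats_apply J K k 1 (\<lambda>j\<in>J. \<lambda>r\<in>{1..k}. \<lambda>c\<in>{1..1}. b j r) y)) (unary_arg J x)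
      = f (scale_args J K k b x)"
    by (simp only: restrict_apply' unary_arg_closed mats_apply_column[OF b])
qed

lemma clonoid_subst_row:
  assumes C: "clonoid C" and k: "k \<ge> 1" and g: "g \<in> kary_part C 1" and a: "a \<in> args J K k"
  shows "(\<lambda>x\<in>args J K k. g (unary_arg J (dot_args J K k a x))) \<in> kary_part C k"
proof -
  have "(\<lambda>x\<in>args J K k. g (unary_arg J (dot_args J K k a x))) = (\<lambda>x\<in>args J K k.
      g (mats_apply J K 1 k (\<lambda>j\<in>J. \<lambda>r\<in>{1..1}. \<lambda>c\<in>{1..k}. a j c) x))"
    by (rule restrict_ext) (simp only: mats_apply_row[OF a])
  then show ?thesis
    using clonoid_subst[OF C k order_refl g row_mats[OF a]] by (simp only:)
qed

lemma clonoid_function_subgroup: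
  assumes C: "clonoid C" and k: "k \<ge> 1"
  shows "function_subgroup PF (args J K k) (kary_part C k)"
proof
  have mem: "f \<in> kary_functions I F J K k" if "f \<in> kary_part C k" for f
    using clonoid_subset[OF C] that by (auto simp: kary_part_def)
  then show "kary_part C k \<subseteq> args J K k \<rightarrow>\<^sub>E carrier PF"
    unfolding kary_functions_def by blast
  obtain n f where nf: "(n, f) \<in> C"
    using C by (auto simp: linearly_closed_clonoid_def)
  then have n: "n \<ge> 1" and fn: "f \<in> kary_part C n"
    using clonoid_subset[OF C] by (auto simp: kary_part_def)
  define b where "b = (\<lambda>j\<in>J. \<lambda>r\<in>{1..n}. \<zero>\<^bsub>K j\<^esub>)"
  have b: "b \<in> args J K n"
    using cring.cring_simprules(2)[OF cring_K] by (auto simp: b_def args_def)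
  obtain g where g: "g \<in> kary_part C k"
    using clonoid_subst[OF C k n fn column_mats[OF b, of k]] by blast
  have val: "f x \<in> carrier PF" if "f \<in> kary_part C k" "x \<in> args J K k" for f x
    using kary_value mem that by blast
  have "(\<lambda>x\<in>args J K k. \<zero>\<^bsub>PF\<^esub> \<otimes>\<^bsub>PF\<^esub> g x \<oplus>\<^bsub>PF\<^esub> \<zero>\<^bsub>PF\<^esub> \<otimes>\<^bsub>PF\<^esub> g x) = (\<lambda>x\<in>args J K k. \<zero>\<^bsub>PF\<^esub>)"
    by (rule restrict_ext) (use val[OF g] in \<open>simp del: prod_ring_simps\<close>)
  then show "(\<lambda>x\<in>args J K k. \<zero>\<^bsub>PF\<^esub>) \<in> kary_part C k"
    using clonoid_lin[OF C k PF.zero_closed PF.zero_closed g g] by simp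
  fix f g assume fg: "f \<in> kary_part C k" "g \<in> kary_part C k"
  have "(\<lambda>x\<in>args J K k. \<one>\<^bsub>PF\<^esub> \<otimes>\<^bsub>PF\<^esub> f x \<oplus>\<^bsub>PF\<^esub> (\<ominus>\<^bsub>PF\<^esub> \<one>\<^bsub>PF\<^esub>) \<otimes>\<^bsub>PF\<^esub> g x)
      = (\<lambda>x\<in>args J K k. f x \<ominus>\<^bsub>PF\<^esub> g x)"
    by (rule restrict_ext)
      (use val[OF fg(1)] val[OF fg(2)] in \<open>simp add: PF.l_minus PF.minus_eq del: prod_ring_simps\<close>)
  then show "(\<lambda>x\<in>args J K k. f x \<ominus>\<^bsub>PF\<^esub> g x) \<in> kary_part C k"
    using clonoid_lin[OF C k PF.one_closed PF.a_inv_closed[OF PF.one_closed] fg] by (simp only:)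
qed

text \<open>A \<open>k\<close>-ary function belongs to a clonoid as soon as all unary functions obtained from it by
  substituting columns do.  The functions obtained by a row and then a column belong to the
  clonoid; by induction on \<open>T\<close>, the rank-one matrices at the factors \<open>j \<in> T\<close> are replaced by identity
  matrices, one factor at a time, using the interpolation over the field \<open>K j\<close>.\<close>

lemma kary_mem_if_rank_one_mem:
  assumes C: "clonoid C" and k: "k \<ge> 1" and f: "f \<in> kary_functions I F J K k"
    and cop: "coprime (card (carrier PK)) (card (carrier PF))"
    and rank_one: "\<And>b. b \<in> args J K k \<Longrightarrow>
      \<exists>g\<in>kary_part C 1. \<forall>x\<in>carrier PK. g (unary_arg J x) = f (scale_args J K k b x)"
  shows "f \<in> kary_part C k"
proof -
  define line where "line j a b x = finite_field_vectors.scale (K j) {1..k}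
    (finite_field_vectors.dot (K j) {1..k} a x) b" for j a b x
  have line_closed: "line j a b x \<in> {1..k} \<rightarrow>\<^sub>E carrier (K j)"
    if "j \<in> J" "a \<in> {1..k} \<rightarrow>\<^sub>E carrier (K j)" "b \<in> {1..k} \<rightarrow>\<^sub>E carrier (K j)" "x \<in> {1..k} \<rightarrow>\<^sub>E carrier (K j)"
    for j a b x
  proof -
    interpret V: finite_field_vectors "K j" "{1..k}" by (rule field_vectors[OF that(1)])
    show ?thesis unfolding line_def using that by (intro V.vectors_closed)
  qed
  have "(\<lambda>x\<in>args J K k. f (\<lambda>j\<in>J. if j \<in> T then x j else line j (a j) (b j) (x j))) \<in> kary_part C k"
    if "finite T" "T \<subseteq> J" "a \<in> args J K k" "b \<in> args J K k" for T a b
    using that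
  proof (induction T arbitrary: a b rule: finite_induct)
    case empty
    obtain g where g: "g \<in> kary_part C 1"
        "\<And>x. x \<in> carrier PK \<Longrightarrow> g (unary_arg J x) = f (scale_args J K k b x)"
      using rank_one[OF empty(3)] by blast
    have "(\<lambda>x\<in>args J K k. f (\<lambda>j\<in>J. if j \<in> {} then x j else line j (a j) (b j) (x j)))
        = (\<lambda>x\<in>args J K k. g (unary_arg J (dot_args J K k a x)))"
    proof (rule restrict_ext)
      fix x assume x: "x \<in> args J K k"
      have "(\<lambda>j\<in>J. line j (a j) (b j) (x j)) = scale_args J K k b (dot_args J K k a x)"
        unfolding scale_args_def
      proof (rule restrict_ext)
        fix j assume j: "j \<in> J"
        interpret V: finite_field_vectors "K j" "{1..k}" by (rule field_vectors[OF j])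
        show "line j (a j) (b j) (x j) = (\<lambda>r\<in>{1..k}. b j r \<otimes>\<^bsub>K j\<^esub> dot_args J K k a x j)"
          unfolding line_def V.scale_def V.dot_def dot_args_def using j by (simp only: restrict_apply')
      qed
      then show "f (\<lambda>j\<in>J. if j \<in> {} then x j else line j (a j) (b j) (x j))
          = g (unary_arg J (dot_args J K k a x))"
        using g(2)[OF dot_args_closed[OF empty(2) x]] by simp
    qed
    then show ?case using clonoid_subst_row[OF C k g(1) empty(2)] by (simp only:)
  next
    case (insert j0 T)
    have j0: "j0 \<in> J" and T: "T \<subseteq> J" using insert by auto
    interpret V: finite_field_vectors "K j0" "{1..k}" by (rule field_vectors[OF j0])
    define h where "h x y = f (\<lambda>j\<in>J. if j \<in> T then x j else if j = j0 then y else line j (a j) (b j) (x j))" for x y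
    have "card (carrier (K j0)) dvd card (carrier PK)"
      using dvd_prodI[of J j0 "\<lambda>j. card (carrier (K j))"] finite_J j0 by (simp add: card_PiE)
    then have cop0: "coprime (card (carrier (K j0))) (card (carrier PF))"
      by (rule coprime_divisors[OF _ dvd_refl cop])
    have "(\<lambda>x\<in>args J K k. h x (x j0)) \<in> kary_part C k"
    proof (rule V.rank_one_interpolation[OF clonoid_function_subgroup[OF C k] cop0])
      fix x y assume x: "x \<in> args J K k" and y: "y \<in> {1..k} \<rightarrow>\<^sub>E carrier (K j0)"
      have "(\<lambda>j\<in>J. if j \<in> T then x j else if j = j0 then y else line j (a j) (b j) (x j)) \<in> args J K k"
        unfolding args_def
        by (rule restrict_PiE_iff[THEN iffD2])
          (use args_mem[OF x] args_mem[OF insert(5)] args_mem[OF insert(6)] y line_closed in simp)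
      then show "h x y \<in> carrier PF"
        unfolding h_def by (rule kary_value[OF f])
    next
      fix a' b' assume a': "a' \<in> {1..k} \<rightarrow>\<^sub>E carrier (K j0)" and b': "b' \<in> {1..k} \<rightarrow>\<^sub>E carrier (K j0)"
      have upd: "a(j0 := a') \<in> args J K k" "b(j0 := b') \<in> args J K k"
        using insert(5,6) a' b' j0 by (auto simp: args_def PiE_iff extensional_def)
      have "(\<lambda>x\<in>args J K k. h x (V.scale (V.dot a' (x j0)) b'))
          = (\<lambda>x\<in>args J K k. f (\<lambda>j\<in>J. if j \<in> T then x j else line j ((a(j0 := a')) j) ((b(j0 := b')) j) (x j)))"
        unfolding h_def
        by (intro restrict_ext arg_cong[where f = f]) (simp add: line_def)
      then show "(\<lambda>x\<in>args J K k. h x (V.scale (V.dot a' (x j0)) b')) \<in> kary_part C k"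
        using insert.IH[OF T upd] by (simp only:)
    qed (rule args_mem[OF _ j0])
    also have "(\<lambda>x\<in>args J K k. h x (x j0))
        = (\<lambda>x\<in>args J K k. f (\<lambda>j\<in>J. if j \<in> insert j0 T then x j else line j (a j) (b j) (x j)))"
      unfolding h_def
      by (intro restrict_ext arg_cong[where f = f]) auto
    finally show ?case .
  qed
  moreover have "(\<lambda>j\<in>J. \<lambda>r\<in>{1..k}. \<zero>\<^bsub>K j\<^esub>) \<in> args J K k"
    using cring.cring_simprules(2)[OF cring_K] by (auto simp: args_def)
  ultimately have "(\<lambda>x\<in>args J K k. f (\<lambda>j\<in>J. if j \<in> J then x j else
      line j ((\<lambda>j\<in>J. \<lambda>r\<in>{1..k}. \<zero>\<^bsub>K j\<^esub>) j) ((\<lambda>j\<in>J. \<lambda>r\<in>{1..k}. \<zero>\<^bsub>K j\<^esub>) j) (x j))) \<in> kary_part C k"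
    using finite_J by blast
  also have "(\<lambda>x\<in>args J K k. f (\<lambda>j\<in>J. if j \<in> J then x j else
      line j ((\<lambda>j\<in>J. \<lambda>r\<in>{1..k}. \<zero>\<^bsub>K j\<^esub>) j) ((\<lambda>j\<in>J. \<lambda>r\<in>{1..k}. \<zero>\<^bsub>K j\<^esub>) j) (x j))) = (\<lambda>x\<in>args J K k. f x)"
  proof (rule restrict_ext, rule arg_cong[where f = f], rule ext)
    fix x j assume "x \<in> args J K k"
    then show "(\<lambda>j\<in>J. if j \<in> J then x j else
      line j ((\<lambda>j\<in>J. \<lambda>r\<in>{1..k}. \<zero>\<^bsub>K j\<^esub>) j) ((\<lambda>j\<in>J. \<lambda>r\<in>{1..k}. \<zero>\<^bsub>K j\<^esub>) j) (x j)) j = x j"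
      by (cases "j \<in> J") (auto simp: args_def PiE_iff extensional_def)
  qed
  also have "\<dots> = f"
    using f unfolding kary_functions_def by (rule PiE_restrict)
  finally show ?thesis .
qed

end

section \<open>The correspondence between clonoids and tuples of submodules\<close>

context field_products
begin

text \<open>The largest clonoid with the prescribed unary part: the functions all of whose unary
  column substitutions lie componentwise in the given subspaces.\<close>

definition clonoid_of :: "('i \<Rightarrow> (('j \<Rightarrow> 'a) \<Rightarrow> 'b) set) \<Rightarrow> (nat \<times> (('j \<Rightarrow> nat \<Rightarrow> 'a) \<Rightarrow> ('i \<Rightarrow> 'b))) set" where
  "clonoid_of V = {(k, f). k \<ge> 1 \<and> f \<in> kary_functions I F J K k \<and>
     (\<forall>b\<in>args J K k. \<forall>i\<in>I. (\<lambda>x\<in>carrier PK. f (scale_args J K k b x) i) \<in> V i)}"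

lemma lin_component:
  "i \<in> I \<Longrightarrow> (a \<otimes>\<^bsub>PF\<^esub> u \<oplus>\<^bsub>PF\<^esub> b \<otimes>\<^bsub>PF\<^esub> w) i = a i \<otimes>\<^bsub>F i\<^esub> u i \<oplus>\<^bsub>F i\<^esub> b i \<otimes>\<^bsub>F i\<^esub> w i"
  by simp

lemma PF_lin_closed:
  assumes "a \<in> carrier PF" "b \<in> carrier PF" "u \<in> carrier PF" "w \<in> carrier PF"
  shows "a \<otimes>\<^bsub>PF\<^esub> u \<oplus>\<^bsub>PF\<^esub> b \<otimes>\<^bsub>PF\<^esub> w \<in> carrier PF"
  by (intro PF.a_closed PF.m_closed assms)

lemma clonoid_all: "clonoid (SIGMA k:{1..}. kary_functions I F J K k)"
proof -
  have "(\<lambda>x\<in>args J K 1. \<zero>\<^bsub>PF\<^esub>) \<in> kary_functions I F J K 1"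
    unfolding kary_functions_def by (rule restrict_PiE_iff[THEN iffD2]) (use PF.zero_closed in blast)
  then have "(1, \<lambda>x\<in>args J K 1. \<zero>\<^bsub>PF\<^esub>) \<in> (SIGMA k:{1..}. kary_functions I F J K k)"
    by blast
  moreover have "(\<lambda>x\<in>args J K n. a \<otimes>\<^bsub>PF\<^esub> f x \<oplus>\<^bsub>PF\<^esub> b \<otimes>\<^bsub>PF\<^esub> g x) \<in> kary_functions I F J K n"
    if "a \<in> carrier PF" "b \<in> carrier PF" "f \<in> kary_functions I F J K n" "g \<in> kary_functions I F J K n" for a b f g n
    unfolding kary_functions_def
    by (rule restrict_PiE_iff[THEN iffD2]) (blast intro: PF_lin_closed that kary_value)
  moreover have "(\<lambda>x\<in>args J K l. f (mats_apply J K n l A x)) \<in> kary_functions I F J K l"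
    if "f \<in> kary_functions I F J K n" "A \<in> mats J K n l" for f n l A
    unfolding kary_functions_def
    by (rule restrict_PiE_iff[THEN iffD2]) (blast intro: that kary_value mats_apply_closed)
  ultimately show ?thesis
    unfolding linearly_closed_clonoid_def kary_part_def by blast
qed

lemma zero_mem_clonoid:
  assumes "clonoid C"
  shows "(1, \<lambda>x\<in>args J K 1. \<zero>\<^bsub>PF\<^esub>) \<in> C"
  using function_subgroup.zero_mem[OF clonoid_function_subgroup[OF assms order_refl]]
  by (simp only: kary_part_def mem_Collect_eq)

lemma clonoid_Inter:
  assumes ne: "S \<noteq> {}" and S: "\<And>C. C \<in> S \<Longrightarrow> clonoid C"
  shows "clonoid (\<Inter>S)"
proof -
  have "(1, \<lambda>x\<in>args J K 1. \<zero>\<^bsub>PF\<^esub>) \<in> \<Inter>S"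
    using zero_mem_clonoid[OF S] by blast
  moreover have "\<Inter>S \<subseteq> (SIGMA k:{1..}. kary_functions I F J K k)"
    using ne S unfolding linearly_closed_clonoid_def by blast
  moreover have part: "f \<in> kary_part (\<Inter>S) n \<longleftrightarrow> (\<forall>C\<in>S. f \<in> kary_part C n)" for f n
    by (simp add: kary_part_def)
  have "(\<lambda>x\<in>args J K n. a \<otimes>\<^bsub>PF\<^esub> f x \<oplus>\<^bsub>PF\<^esub> b \<otimes>\<^bsub>PF\<^esub> g x) \<in> kary_part (\<Inter>S) n"
    if "n \<ge> 1" "a \<in> carrier PF" "b \<in> carrier PF" "f \<in> kary_part (\<Inter>S) n" "g \<in> kary_part (\<Inter>S) n" for n a b f g
    unfolding part using clonoid_lin[OF S that(1-3)] that(4,5)[unfolded part] by blast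
  moreover have "(\<lambda>x\<in>args J K l. f (mats_apply J K n l A x)) \<in> kary_part (\<Inter>S) l"
    if "l \<ge> 1" "n \<ge> 1" "f \<in> kary_part (\<Inter>S) n" "A \<in> mats J K n l" for l n f A
    unfolding part using clonoid_subst[OF S that(1,2) _ that(4)] that(3)[unfolded part] by blast
  ultimately show ?thesis
    unfolding linearly_closed_clonoid_def by blast
qed

lemma partial_order_clonoid_lattice: "partial_order (clonoid_lattice I F J K)"
  by unfold_locales (auto simp: clonoid_lattice_def)

lemma complete_lattice_clonoid_lattice: "complete_lattice (clonoid_lattice I F J K)"
proof -
  interpret partial_order "clonoid_lattice I F J K" by (rule partial_order_clonoid_lattice)
  show ?thesis
  proof (rule complete_lattice_criterion1)
    show "\<exists>g. greatest (clonoid_lattice I F J K) g (carrier (clonoid_lattice I F J K))"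
      by (rule exI[where x = "SIGMA k:{1..}. kary_functions I F J K k"])
        (use clonoid_all clonoid_subset in \<open>auto simp: greatest_def clonoid_lattice_def\<close>)
    fix S assume "S \<subseteq> carrier (clonoid_lattice I F J K)" "S \<noteq> {}"
    then show "\<exists>i. greatest (clonoid_lattice I F J K) i (Lower (clonoid_lattice I F J K) S)"
      using clonoid_Inter[of S]
      by (intro exI[where x = "\<Inter>S"]) (auto simp: greatest_def Lower_def clonoid_lattice_def)
  qed
qed

text \<open>Closure under substitution rests on the fact that a matrix applied to a column is again a
  column, so the condition on \<open>f(A y)\<close> is an instance of the condition on \<open>f\<close>.\<close>

lemma clonoid_clonoid_of:
  assumes V: "\<And>i. i \<in> I \<Longrightarrow> scaling_closed_subspace (F i) PK (V i)"
  shows "clonoid (clonoid_of V)"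
proof -
  have lin: "(\<lambda>x\<in>carrier PK. c \<otimes>\<^bsub>F i\<^esub> u x \<oplus>\<^bsub>F i\<^esub> d \<otimes>\<^bsub>F i\<^esub> w x) \<in> V i"
    if "i \<in> I" "c \<in> carrier (F i)" "d \<in> carrier (F i)" "u \<in> V i" "w \<in> V i" for i c d u w
    using V[OF that(1)] that(2-) unfolding scaling_closed_subspace_def by blast
  have zero: "(\<lambda>x\<in>carrier PK. \<zero>\<^bsub>F i\<^esub>) \<in> V i" if "i \<in> I" for i
    using V[OF that] unfolding scaling_closed_subspace_def by blast
  have all_zero: "(1, \<lambda>x\<in>args J K 1. \<zero>\<^bsub>PF\<^esub>) \<in> clonoid_of V"
  proof -
    have "(\<lambda>x\<in>carrier PK. (\<lambda>x\<in>args J K 1. \<zero>\<^bsub>PF\<^esub>) (scale_args J K 1 b x) i) \<in> V i"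
      if b: "b \<in> args J K 1" and i: "i \<in> I" for b i
    proof -
      have "(\<lambda>x\<in>carrier PK. (\<lambda>x\<in>args J K 1. \<zero>\<^bsub>PF\<^esub>) (scale_args J K 1 b x) i) = (\<lambda>x\<in>carrier PK. \<zero>\<^bsub>F i\<^esub>)"
        by (rule restrict_ext) (simp only: restrict_apply' scale_args_closed[OF b] prod_ring_simps(4) i)
      then show ?thesis using zero[OF i] by (simp only:)
    qed
    moreover have "(\<lambda>x\<in>args J K 1. \<zero>\<^bsub>PF\<^esub>) \<in> kary_functions I F J K 1"
      using clonoid_subset[OF clonoid_all zero_mem_clonoid[OF clonoid_all]] by blast
    ultimately show ?thesis unfolding clonoid_of_def by blast
  qed
  have kary: "f \<in> kary_functions I F J K n"
    and comp: "\<And>b i. b \<in> args J K n \<Longrightarrow> i \<in> I \<Longrightarrow> (\<lambda>x\<in>carrier PK. f (scale_args J K n b x) i) \<in> V i"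
    if "f \<in> kary_part (clonoid_of V) n" for f n
    using that by (auto simp: kary_part_def clonoid_of_def)
  have memI: "f \<in> kary_part (clonoid_of V) n"
    if "n \<ge> 1" "f \<in> kary_part (SIGMA k:{1..}. kary_functions I F J K k) n"
      "\<And>b i. b \<in> args J K n \<Longrightarrow> i \<in> I \<Longrightarrow> (\<lambda>x\<in>carrier PK. f (scale_args J K n b x) i) \<in> V i" for f n
    using that by (auto simp: kary_part_def clonoid_of_def)
  have all: "f \<in> kary_part (SIGMA k:{1..}. kary_functions I F J K k) n"
    if "n \<ge> 1" "f \<in> kary_part (clonoid_of V) n" for f n
    using that(1) kary[OF that(2)] by (auto simp: kary_part_def)
  have "(\<lambda>x\<in>args J K n. a \<otimes>\<^bsub>PF\<^esub> f x \<oplus>\<^bsub>PF\<^esub> b \<otimes>\<^bsub>PF\<^esub> g x) \<in> kary_part (clonoid_of V) n"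
    if n: "n \<ge> 1" and ab: "a \<in> carrier PF" "b \<in> carrier PF"
      and fg: "f \<in> kary_part (clonoid_of V) n" "g \<in> kary_part (clonoid_of V) n" for n a b f g
  proof (rule memI[OF n clonoid_lin[OF clonoid_all n ab all[OF n fg(1)] all[OF n fg(2)]]])
    fix e i assume e: "e \<in> args J K n" and i: "i \<in> I"
    have abi: "a i \<in> carrier (F i)" "b i \<in> carrier (F i)"
      using ab i by auto
    have "(\<lambda>x\<in>carrier PK. (\<lambda>x\<in>args J K n. a \<otimes>\<^bsub>PF\<^esub> f x \<oplus>\<^bsub>PF\<^esub> b \<otimes>\<^bsub>PF\<^esub> g x) (scale_args J K n e x) i)
      = (\<lambda>x\<in>carrier PK. a i \<otimes>\<^bsub>F i\<^esub> (\<lambda>x\<in>carrier PK. f (scale_args J K n e x) i) x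
          \<oplus>\<^bsub>F i\<^esub> b i \<otimes>\<^bsub>F i\<^esub> (\<lambda>x\<in>carrier PK. g (scale_args J K n e x) i) x)"
      by (rule restrict_ext) (simp only: restrict_apply' scale_args_closed[OF e] lin_component[OF i])
    then show "(\<lambda>x\<in>carrier PK. (\<lambda>x\<in>args J K n. a \<otimes>\<^bsub>PF\<^esub> f x \<oplus>\<^bsub>PF\<^esub> b \<otimes>\<^bsub>PF\<^esub> g x) (scale_args J K n e x) i) \<in> V i"
      using lin[OF i abi comp[OF fg(1) e i] comp[OF fg(2) e i]] by (simp only:)
  qed
  moreover have "(\<lambda>x\<in>args J K l. f (mats_apply J K n l A x)) \<in> kary_part (clonoid_of V) l"
    if l: "l \<ge> 1" and n: "n \<ge> 1" and f: "f \<in> kary_part (clonoid_of V) n" and A: "A \<in> mats J K n l" for l n f A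
  proof (rule memI[OF l clonoid_subst[OF clonoid_all l n all[OF n f] A]])
    fix b i assume b: "b \<in> args J K l" and i: "i \<in> I"
    have "(\<lambda>x\<in>carrier PK. (\<lambda>x\<in>args J K l. f (mats_apply J K n l A x)) (scale_args J K l b x) i)
      = (\<lambda>x\<in>carrier PK. f (scale_args J K n (mats_apply J K n l A b) x) i)"
      by (rule restrict_ext) (simp only: restrict_apply' scale_args_closed[OF b] mats_apply_scale_args[OF A b])
    then show "(\<lambda>x\<in>carrier PK. (\<lambda>x\<in>args J K l. f (mats_apply J K n l A x)) (scale_args J K l b x) i) \<in> V i"
      using comp[OF f mats_apply_closed[OF A b] i] by (simp only:)
  qed
  moreover have "clonoid_of V \<subseteq> (SIGMA k:{1..}. kary_functions I F J K k)"
    by (auto simp: clonoid_of_def)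
  ultimately show ?thesis
    unfolding linearly_closed_clonoid_def using all_zero by blast
qed

lemma scale_unary_arg:
  assumes "a \<in> carrier PK" "x \<in> carrier PK"
  shows "scale_args J K 1 (unary_arg J a) x = unary_arg J (a \<otimes>\<^bsub>PK\<^esub> x)"
  unfolding scale_args_def unary_arg_def by (intro restrict_ext) simp

lemma ex_unary_arg:
  assumes "y \<in> args J K 1"
  obtains x where "x \<in> carrier PK" "y = unary_arg J x"
  using assms bij_betw_unary_arg[of J K] unfolding bij_betw_def by blast

lemma unary_part_component:
  "i \<in> I \<Longrightarrow> unary_part I J K C i = {(\<lambda>x\<in>carrier PK. f (unary_arg J x) i) | f. f \<in> kary_part C 1}"
  by (simp only: unary_part_def restrict_apply')

lemma clonoid_kary: "clonoid C \<Longrightarrow> f \<in> kary_part C k \<Longrightarrow> f \<in> kary_functions I F J K k"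
  using clonoid_subset by (simp add: kary_part_def)

lemma scaling_closed_unary_part:
  assumes C: "clonoid C" and i: "i \<in> I"
  shows "scaling_closed_subspace (F i) PK (unary_part I J K C i)"
proof -
  let ?u = "\<lambda>f. \<lambda>x\<in>carrier PK. f (unary_arg J x) i"
  have "?u f \<in> carrier PK \<rightarrow>\<^sub>E carrier (F i)" if "f \<in> kary_part C 1" for f
    by (rule restrict_PiE_iff[THEN iffD2])
      (use kary_component[OF clonoid_kary[OF C that] unary_arg_closed i] in blast)
  moreover have "\<exists>f. (\<lambda>x\<in>carrier PK. \<zero>\<^bsub>F i\<^esub>) = ?u f \<and> f \<in> kary_part C 1"
  proof (intro exI conjI)
    show "(\<lambda>x\<in>args J K 1. \<zero>\<^bsub>PF\<^esub>) \<in> kary_part C 1"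
      using zero_mem_clonoid[OF C] unfolding kary_part_def by blast
    show "(\<lambda>x\<in>carrier PK. \<zero>\<^bsub>F i\<^esub>) = ?u (\<lambda>x\<in>args J K 1. \<zero>\<^bsub>PF\<^esub>)"
      by (rule restrict_ext) (simp only: restrict_apply' unary_arg_closed prod_ring_simps(4) i)
  qed
  moreover have "\<exists>h. (\<lambda>x\<in>carrier PK. c \<otimes>\<^bsub>F i\<^esub> ?u f x \<oplus>\<^bsub>F i\<^esub> d \<otimes>\<^bsub>F i\<^esub> ?u g x) = ?u h \<and> h \<in> kary_part C 1"
    if cd: "c \<in> carrier (F i)" "d \<in> carrier (F i)" and fg: "f \<in> kary_part C 1" "g \<in> kary_part C 1" for c d f g
  proof (intro exI conjI)
    define lift where "lift e = (\<lambda>i'\<in>I. if i' = i then e else \<zero>\<^bsub>F i'\<^esub>)" for e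
    have lift: "lift e \<in> carrier PF" if "e \<in> carrier (F i)" for e
      using that cring.cring_simprules(2)[OF cring_F] by (auto simp: lift_def)
    let ?h = "\<lambda>x\<in>args J K 1. lift c \<otimes>\<^bsub>PF\<^esub> f x \<oplus>\<^bsub>PF\<^esub> lift d \<otimes>\<^bsub>PF\<^esub> g x"
    show "?h \<in> kary_part C 1"
      by (rule clonoid_lin[OF C order_refl lift[OF cd(1)] lift[OF cd(2)] fg])
    have lift_i: "lift e i = e" for e using i by (simp add: lift_def)
    show "(\<lambda>x\<in>carrier PK. c \<otimes>\<^bsub>F i\<^esub> ?u f x \<oplus>\<^bsub>F i\<^esub> d \<otimes>\<^bsub>F i\<^esub> ?u g x) = ?u ?h"
      by (rule restrict_ext) (simp only: restrict_apply' unary_arg_closed lin_component[OF i] lift_i)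
  qed
  moreover have "\<exists>h. (\<lambda>x\<in>carrier PK. ?u f (a \<otimes>\<^bsub>PK\<^esub> x)) = ?u h \<and> h \<in> kary_part C 1"
    if a: "a \<in> carrier PK" and f: "f \<in> kary_part C 1" for a f
  proof -
    obtain h where h: "h \<in> kary_part C 1"
      "\<And>x. x \<in> carrier PK \<Longrightarrow> h (unary_arg J x) = f (scale_args J K 1 (unary_arg J a) x)"
      using clonoid_subst_column[OF C order_refl f unary_arg_closed[OF a]] by blast
    have "(\<lambda>x\<in>carrier PK. ?u f (a \<otimes>\<^bsub>PK\<^esub> x)) = ?u h"
      by (rule restrict_ext)
        (simp only: restrict_apply' PK.m_closed[OF a] h(2) scale_unary_arg[OF a])
    then show ?thesis using h(1) by blast
  qed
  ultimately show ?thesis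
    unfolding scaling_closed_subspace_def unary_part_component[OF i] by blast
qed

text \<open>Substituting the column \<open>1\<close> shows that unary members have their components in \<open>V\<close>.  Conversely,
  \<open>v \<in> V i\<close> is the \<open>i\<close>-th component of a unary function that vanishes in all other components, and for
  such a function column substitution is multiplication of the argument by an element of \<open>K\<close>.\<close>

lemma unary_part_clonoid_of:
  assumes V: "\<And>i. i \<in> I \<Longrightarrow> scaling_closed_subspace (F i) PK (V i)"
    and ext: "V \<in> extensional I"
  shows "unary_part I J K (clonoid_of V) = V"
proof (rule extensionalityI[of _ I])
  show "unary_part I J K (clonoid_of V) \<in> extensional I" by (simp add: unary_part_def)
  fix i assume i: "i \<in> I"
  have sub: "V i \<subseteq> carrier PK \<rightarrow>\<^sub>E carrier (F i)"
    and zero: "\<And>i. i \<in> I \<Longrightarrow> (\<lambda>x\<in>carrier PK. \<zero>\<^bsub>F i\<^esub>) \<in> V i"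
    and trans: "\<And>a v. a \<in> carrier PK \<Longrightarrow> v \<in> V i \<Longrightarrow> (\<lambda>x\<in>carrier PK. v (a \<otimes>\<^bsub>PK\<^esub> x)) \<in> V i"
    using V i unfolding scaling_closed_subspace_def by blast+
  have "(\<lambda>x\<in>carrier PK. f (unary_arg J x) i) \<in> V i" if f: "f \<in> kary_part (clonoid_of V) 1" for f
  proof -
    have "(\<lambda>x\<in>carrier PK. f (scale_args J K 1 (unary_arg J \<one>\<^bsub>PK\<^esub>) x) i) \<in> V i"
      using f i unary_arg_closed[OF PK.one_closed] unfolding kary_part_def clonoid_of_def by blast
    moreover have "(\<lambda>x\<in>carrier PK. f (scale_args J K 1 (unary_arg J \<one>\<^bsub>PK\<^esub>) x) i)
        = (\<lambda>x\<in>carrier PK. f (unary_arg J x) i)"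
      by (rule restrict_ext) (simp only: scale_unary_arg[OF PK.one_closed] PK.l_one)
    ultimately show ?thesis by (simp only:)
  qed
  moreover have "\<exists>f. v = (\<lambda>x\<in>carrier PK. f (unary_arg J x) i) \<and> f \<in> kary_part (clonoid_of V) 1"
    if v: "v \<in> V i" for v
  proof -
    define f where "f = (\<lambda>y\<in>args J K 1. \<lambda>i'\<in>I. if i' = i then v (\<lambda>j\<in>J. y j 1) else \<zero>\<^bsub>F i'\<^esub>)"
    have f: "f (unary_arg J x) i' = (if i' = i then v x else \<zero>\<^bsub>F i'\<^esub>)" if x: "x \<in> carrier PK" and "i' \<in> I" for x i'
    proof -
      have "(\<lambda>j\<in>J. unary_arg J x j 1) = x"
        using x by (auto simp: unary_arg_def PiE_iff extensional_def)
      then show ?thesis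
        unfolding f_def restrict_apply'[OF unary_arg_closed[OF x]] using that by simp
    qed
    have vx: "v x \<in> carrier (F i)" if "x \<in> carrier PK" for x
      using sub v that by blast
    have "f y \<in> carrier PF" if y: "y \<in> args J K 1" for y
    proof -
      obtain x where x: "x \<in> carrier PK" "y = unary_arg J x" using ex_unary_arg[OF y] .
      have "f y i' \<in> carrier (F i')" if "i' \<in> I" for i'
        using f[OF x(1) that] vx[OF x(1)] cring.cring_simprules(2)[OF cring_F[OF that]] x(2) by auto
      moreover have "f y \<in> extensional I"
        using y by (simp add: f_def)
      ultimately show ?thesis by (simp add: PiE_def)
    qed
    then have kary: "f \<in> kary_functions I F J K 1"
      unfolding kary_functions_def by (intro PiE_I) (simp_all add: f_def)
    have "(\<lambda>x\<in>carrier PK. f (scale_args J K 1 b x) i') \<in> V i'" if b: "b \<in> args J K 1" and i': "i' \<in> I" for b i'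
    proof -
      obtain a where a: "a \<in> carrier PK" "b = unary_arg J a" using ex_unary_arg[OF b] .
      have "(\<lambda>x\<in>carrier PK. f (scale_args J K 1 b x) i')
          = (\<lambda>x\<in>carrier PK. if i' = i then v (a \<otimes>\<^bsub>PK\<^esub> x) else \<zero>\<^bsub>F i'\<^esub>)"
        by (rule restrict_ext) (simp only: a(2) scale_unary_arg[OF a(1)] f[OF PK.m_closed[OF a(1)] i'])
      also have "\<dots> \<in> V i'"
        using trans[OF a(1) v] zero[OF i'] by (cases "i' = i") (simp_all only: if_True if_False simp_thms)
      finally show ?thesis .
    qed
    then have "f \<in> kary_part (clonoid_of V) 1"
      using kary unfolding kary_part_def clonoid_of_def by blast
    moreover have "v = (\<lambda>x\<in>carrier PK. f (unary_arg J x) i)"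
    proof -
      have "(\<lambda>x\<in>carrier PK. f (unary_arg J x) i) = (\<lambda>x\<in>carrier PK. v x)"
        by (rule restrict_ext) (simp only: f[OF _ i] if_True simp_thms)
      also have "\<dots> = v"
        using subsetD[OF sub v] by (rule PiE_restrict)
      finally show ?thesis by (rule sym)
    qed
    ultimately show ?thesis by blast
  qed
  ultimately show "unary_part I J K (clonoid_of V) i = V i"
    unfolding unary_part_component[OF i] by blast
qed (rule ext)

text \<open>The unary part of a clonoid is the full product of its projections: the idempotents of the
  product ring \<open>F\<close> are allowed as coefficients, so components of different members can be combined
  into one member.\<close>

lemma ex_unary_member_with_components:
  assumes C: "clonoid C"
    and u: "\<And>x. x \<in> carrier PK \<Longrightarrow> u x \<in> carrier PF"
    and parts: "\<And>i. i \<in> I \<Longrightarrow> (\<lambda>x\<in>carrier PK. u x i) \<in> unary_part I J K C i"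
  shows "\<exists>g\<in>kary_part C 1. \<forall>x\<in>carrier PK. g (unary_arg J x) = u x"
proof -
  have "\<exists>g\<in>kary_part C 1. \<forall>i\<in>T. \<forall>x\<in>carrier PK. g (unary_arg J x) i = u x i" if "finite T" "T \<subseteq> I" for T
    using that
  proof (induction T rule: finite_induct)
    case empty
    then show ?case
      using zero_mem_clonoid[OF C] unfolding kary_part_def by blast
  next
    case (insert i T)
    then obtain g where g: "g \<in> kary_part C 1"
      "\<And>i x. i \<in> T \<Longrightarrow> x \<in> carrier PK \<Longrightarrow> g (unary_arg J x) i = u x i" by blast
    have i: "i \<in> I" using insert by simp
    obtain f where f: "f \<in> kary_part C 1" "(\<lambda>x\<in>carrier PK. u x i) = (\<lambda>x\<in>carrier PK. f (unary_arg J x) i)"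
      using parts[OF i] unfolding unary_part_component[OF i] by blast
    have fu: "f (unary_arg J x) i = u x i" if "x \<in> carrier PK" for x
      using fun_cong[OF f(2), of x] by (simp only: restrict_apply'[OF that])
    \<comment> \<open>The complementary idempotents \<open>e\<close> and \<open>e'\<close> replace the component \<open>i\<close> of \<open>g\<close> by that of \<open>f\<close>.\<close>
    define e where "e = (\<lambda>i'\<in>I. if i = i' then \<zero>\<^bsub>F i'\<^esub> else \<one>\<^bsub>F i'\<^esub>)"
    define e' where "e' = (\<lambda>i'\<in>I. if i = i' then \<one>\<^bsub>F i'\<^esub> else \<zero>\<^bsub>F i'\<^esub>)"
    have e: "e \<in> carrier PF" "e' \<in> carrier PF"
      using cring.cring_simprules(2,6)[OF cring_F] by (auto simp: e_def e'_def)
    let ?h = "\<lambda>x\<in>args J K 1. e \<otimes>\<^bsub>PF\<^esub> g x \<oplus>\<^bsub>PF\<^esub> e' \<otimes>\<^bsub>PF\<^esub> f x"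
    have "?h (unary_arg J x) i' = u x i'" if i': "i' \<in> insert i T" and x: "x \<in> carrier PK" for i' x
    proof -
      have I': "i' \<in> I" using i' insert by auto
      interpret cring "F i'" by (rule cring_F[OF I'])
      have c: "g (unary_arg J x) i' \<in> carrier (F i')" "f (unary_arg J x) i' \<in> carrier (F i')"
        using kary_component[OF clonoid_kary[OF C g(1)] unary_arg_closed[OF x] I']
          kary_component[OF clonoid_kary[OF C f(1)] unary_arg_closed[OF x] I'] by auto
      have "?h (unary_arg J x) i' = e i' \<otimes>\<^bsub>F i'\<^esub> g (unary_arg J x) i' \<oplus>\<^bsub>F i'\<^esub> e' i' \<otimes>\<^bsub>F i'\<^esub> f (unary_arg J x) i'"
        by (simp only: restrict_apply'[OF unary_arg_closed[OF x]] lin_component[OF I'])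
      also have "\<dots> = (if i = i' then f (unary_arg J x) i' else g (unary_arg J x) i')"
        using c I' by (simp add: e_def e'_def)
      also have "\<dots> = u x i'"
        using fu[OF x] g(2)[OF _ x, of i'] i' by auto
      finally show ?thesis .
    qed
    then show ?case
      using clonoid_lin[OF C order_refl e g(1) f(1)] by blast
  qed
  from this[OF finite_I order_refl] obtain g where g: "g \<in> kary_part C 1"
    "\<And>i x. i \<in> I \<Longrightarrow> x \<in> carrier PK \<Longrightarrow> g (unary_arg J x) i = u x i" by blast
  have "g (unary_arg J x) = u x" if x: "x \<in> carrier PK" for x
    using kary_value[OF clonoid_kary[OF C g(1)] unary_arg_closed[OF x]] u[OF x] g(2)[OF _ x]
    unfolding prod_ring_simps(1) by (rule PiE_ext)
  then show ?thesis using g(1) by blast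
qed

text \<open>The inclusion of \<open>C\<close> in the largest clonoid with its unary part is closure under substitution;
  the other inclusion is the interpolation theorem, and it says that a clonoid is generated by its
  unary part.\<close>

lemma clonoid_of_unary_part:
  assumes C: "clonoid C" and cop: "coprime (card (carrier PK)) (card (carrier PF))"
  shows "clonoid_of (unary_part I J K C) = C"
proof
  show "C \<subseteq> clonoid_of (unary_part I J K C)"
  proof
    fix kf assume kf: "kf \<in> C"
    obtain k f where [simp]: "kf = (k, f)" by (cases kf)
    have k: "k \<ge> 1" and f: "f \<in> kary_functions I F J K k" "f \<in> kary_part C k"
      using clonoid_subset[OF C] kf by (auto simp: kary_part_def)
    have "(\<lambda>x\<in>carrier PK. f (scale_args J K k b x) i) \<in> unary_part I J K C i"
      if b: "b \<in> args J K k" and i: "i \<in> I" for b i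
    proof -
      obtain g where g: "g \<in> kary_part C 1"
        "\<And>x. x \<in> carrier PK \<Longrightarrow> g (unary_arg J x) = f (scale_args J K k b x)"
        using clonoid_subst_column[OF C k f(2) b] by blast
      have "(\<lambda>x\<in>carrier PK. f (scale_args J K k b x) i) = (\<lambda>x\<in>carrier PK. g (unary_arg J x) i)"
        by (rule restrict_ext) (simp only: g(2))
      then show ?thesis unfolding unary_part_component[OF i] using g(1) by blast
    qed
    then show "kf \<in> clonoid_of (unary_part I J K C)"
      using k f(1) unfolding clonoid_of_def by simp
  qed
  show "clonoid_of (unary_part I J K C) \<subseteq> C"
  proof
    fix kf assume kf: "kf \<in> clonoid_of (unary_part I J K C)"
    obtain k f where [simp]: "kf = (k, f)" by (cases kf)
    have k: "k \<ge> 1" and f: "f \<in> kary_functions I F J K k"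
      and parts: "\<And>b i. b \<in> args J K k \<Longrightarrow> i \<in> I \<Longrightarrow>
        (\<lambda>x\<in>carrier PK. f (scale_args J K k b x) i) \<in> unary_part I J K C i"
      using kf unfolding clonoid_of_def by auto
    have "f \<in> kary_part C k"
    proof (rule kary_mem_if_rank_one_mem[OF C k f cop])
      fix b assume b: "b \<in> args J K k"
      show "\<exists>g\<in>kary_part C 1. \<forall>x\<in>carrier PK. g (unary_arg J x) = f (scale_args J K k b x)"
        by (rule ex_unary_member_with_components[OF C kary_value[OF f scale_args_closed[OF b]] parts[OF b]])
    qed
    then show "kf \<in> C" by (simp add: kary_part_def)
  qed
qed

lemma clonoid_of_mono:
  assumes "\<And>i. i \<in> I \<Longrightarrow> V i \<subseteq> W i"
  shows "clonoid_of V \<subseteq> clonoid_of W"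
  using assms unfolding clonoid_of_def by blast

lemma unary_part_mono: "C \<subseteq> D \<Longrightarrow> i \<in> I \<Longrightarrow> unary_part I J K C i \<subseteq> unary_part I J K D i"
  unfolding unary_part_component kary_part_def by blast

theorem lattice_iso_unary_part:
  assumes cop: "coprime (card (carrier PK)) (card (carrier PF))"
  shows "lattice_iso (unary_part I J K) (clonoid_lattice I F J K)
    (prod_order I (\<lambda>i. submodule_lattice (F i) PK))"
proof -
  let ?P = "prod_order I (\<lambda>i. submodule_lattice (F i) PK)"
  have sub_iff: "submodule V (monoid_ring (F i) PK) (function_module (F i) PK) \<longleftrightarrow> scaling_closed_subspace (F i) PK V"
    if i: "i \<in> I" for i V
    by (rule submodule_iff_scaling_closed_subspace[OF cring_F[OF i] PK.comm_monoid_axioms])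
      (use domain.one_not_zero[OF field.axioms(1)[OF field_F[OF i]]] in simp)
  have carrier_P: "V \<in> carrier ?P \<longleftrightarrow> V \<in> extensional I \<and> (\<forall>i\<in>I. scaling_closed_subspace (F i) PK (V i))" for V
    unfolding prod_order_def submodule_lattice_def
    by (auto simp: PiE_iff sub_iff simp del: prod_ring_simps)
  have le_P: "V \<sqsubseteq>\<^bsub>?P\<^esub> W \<longleftrightarrow> (\<forall>i\<in>I. V i \<subseteq> W i)" for V W
    by (simp add: prod_order_def submodule_lattice_def)
  have eq_P: "(.=\<^bsub>?P\<^esub>) = (=)"
    by (simp add: prod_order_def)
  have antisym: "V = W"
    if "V \<in> carrier ?P" "W \<in> carrier ?P" "\<forall>i\<in>I. V i \<subseteq> W i" "\<forall>i\<in>I. W i \<subseteq> V i" for V W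
    using that unfolding carrier_P by (intro extensionalityI[of V I W]) auto
  interpret L: complete_lattice "clonoid_lattice I F J K" by (rule complete_lattice_clonoid_lattice)
  show ?thesis
  proof (rule lattice_iso_if_order_iso)
    show "lattice (clonoid_lattice I F J K)" by (rule L.lattice_axioms)
    show "partial_order ?P"
      by unfold_locales (auto simp: eq_P le_P intro: antisym)
    show "bij_betw (unary_part I J K) (carrier (clonoid_lattice I F J K)) (carrier ?P)"
    proof (rule bij_betwI[where g = clonoid_of])
      show "unary_part I J K \<in> carrier (clonoid_lattice I F J K) \<rightarrow> carrier ?P"
        using scaling_closed_unary_part unfolding Pi_def carrier_P
        by (simp add: clonoid_lattice_def) (simp add: unary_part_def)
      show "clonoid_of \<in> carrier ?P \<rightarrow> carrier (clonoid_lattice I F J K)"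
        using clonoid_clonoid_of unfolding Pi_def carrier_P by (simp add: clonoid_lattice_def)
      show "clonoid_of (unary_part I J K C) = C" if "C \<in> carrier (clonoid_lattice I F J K)" for C
        using that clonoid_of_unary_part[OF _ cop] by (simp add: clonoid_lattice_def)
      show "unary_part I J K (clonoid_of V) = V" if "V \<in> carrier ?P" for V
        using that unary_part_clonoid_of unfolding carrier_P by blast
    qed
    fix C D assume CD: "C \<in> carrier (clonoid_lattice I F J K)" "D \<in> carrier (clonoid_lattice I F J K)"
    have "C \<subseteq> D \<longleftrightarrow> (\<forall>i\<in>I. unary_part I J K C i \<subseteq> unary_part I J K D i)"
      using unary_part_mono[of C D] clonoid_of_mono[of "unary_part I J K C" "unary_part I J K D"]
        clonoid_of_unary_part[OF _ cop] CD by (auto simp: clonoid_lattice_def)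
    then show "unary_part I J K C \<sqsubseteq>\<^bsub>?P\<^esub> unary_part I J K D \<longleftrightarrow> C \<sqsubseteq>\<^bsub>clonoid_lattice I F J K\<^esub> D"
      by (simp add: le_P clonoid_lattice_def)
  qed
qed

end

theorem corollary4p4:
  fixes m s :: nat
    and K :: "nat \<Rightarrow> ('a, 'c) ring_scheme"
    and F :: "nat \<Rightarrow> ('b, 'd) ring_scheme"
  assumes "m \<ge> 1" and "s \<ge> 1"
    and "\<And>j. j \<in> {1..m} \<Longrightarrow> field (K j)"
    and "\<And>j. j \<in> {1..m} \<Longrightarrow> finite (carrier (K j))"
    and "\<And>i. i \<in> {1..s} \<Longrightarrow> field (F i)"
    and "\<And>i. i \<in> {1..s} \<Longrightarrow> finite (carrier (F i))"
    and "coprime (card (carrier (prod_ring {1..m} K))) (card (carrier (prod_ring {1..s} F)))"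
  shows "lattice_iso (unary_part {1..s} {1..m} K)
           (clonoid_lattice {1..s} F {1..m} K)
           (prod_order {1..s} (\<lambda>i. submodule_lattice (F i) (prod_ring {1..m} K)))"
proof -
  interpret field_products "{1..s}" F "{1..m}" K
    by (rule field_products.intro) (rule finite_atLeastAtMost assms | assumption)+
  show ?thesis
    by (rule lattice_iso_unary_part[OF assms(7)])
qed

end
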